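(* Let $X$ be a Banach space and $G \subseteq \mathcal{L}(X)$ be a group of isometries. If $X$ satisfies property quasi-$\alpha$-$G$, then $\operatorname{NA}_G(X,Y)$ is dense in $\mathcal{L}_G(X,Y)$ for every Banach space $Y$.
   Context: Banach spaces are over $\mathbb{K}\in\{\mathbb{R},\mathbb{C}\}$; $B_Z$, $S_Z$, $Z^*$ denote the closed unit ball, unit sphere and dual of $Z$; $\operatorname{ext}(B)$ is the set of extreme points of $B$. $\mathcal{L}(X,Y)$ is the space of bounded linear operators with the operator norm, $\mathcal{L}(X)=\mathcal{L}(X,X)$. A group of isometries $G\subseteq\mathcal{L}(X)$ is a group under composition of isometric isomorphisms of $X$. $T\in\mathcal{L}(X,Y)$ is $G$-invariant if $T(g(x))=T(x)$ for all $x\in X$, $g\in G$ (in particular this applies to functionals); $\mathcal{L}_G(X,Y)$ is the set of $G$-invariant operators. $T$ is norm-attaining if there is $x_0\in B_X$ with $\|T(x_0)\|=\|T\|$; $\operatorname{NA}_G(X,Y)$ is the set of norm-attaining $T\in\mathcal{L}_G(X,Y)$. Density is in the operator norm. Property quasi-$\alpha$-$G$: $X$ has this property if there exist $A=\{x_\lambda:\lambda\in\Lambda\}\subseteq S_X$, $A^*=\{x_\lambda^*:\lambda\in\Lambda\}\subseteq S_{X^*}$ and a function $\rho:A\to\mathbb{R}$ such that (i) $x_\lambda^*$ is $G$-invariant for every $\lambda\in\Lambda$; (ii) $x_\lambda^*(x_\lambda)=1$ for every $\lambda\in\Lambda$; (iii) $|x_\lambda^*(x_\mu)|\le\rho(x_\lambda)<1$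 for all $\lambda\neq\mu$ in $\Lambda$; (iv) for every $e\in\operatorname{ext}(B_{X^{**}})$ there are a subset $A_e\subseteq A$ and a scalar $t$ with $|t|=1$ such that $te\in\overline{Q(G(A_e))}^{w^*}$ and $r_e:=\sup\{\rho(x):x\in A_e\}<1$, where $Q:X\hookrightarrow X^{**}$ is the canonical embedding and $G(A_e)=\{g(x):g\in G,\ x\in A_e\}$. *)

theory Defs
  imports "HOL-Analysis.Analysis" "HOL-Library.Function_Algebras"
begin

text \<open>
  The scalar fields \<open>\<real>\<close> and \<open>\<complex>\<close> are treated together: a field in the class below is
  isometrically isomorphic, over \<open>\<real>\<close>, to a subfield of \<open>\<complex>\<close> containing \<open>\<real>\<close>, that is, to
  \<open>\<real>\<close> or to \<open>\<complex>\<close>.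
\<close>

class real_or_complex_field = real_normed_field +
  assumes ex_complex_embedding:
    "\<exists>\<phi> :: 'a \<Rightarrow> complex.
       (\<forall>a b. \<phi> (a + b) = \<phi> a + \<phi> b) \<and> (\<forall>a b. \<phi> (a * b) = \<phi> a * \<phi> b) \<and>
       (\<forall>r a. \<phi> (r *\<^sub>R a) = r *\<^sub>R \<phi> a) \<and> (\<forall>a. norm (\<phi> a) = norm a)"

instance real :: real_or_complex_field
  proof
  show "\<exists>\<phi> :: real \<Rightarrow> complex.
       (\<forall>a b. \<phi> (a + b) = \<phi> a + \<phi> b) \<and> (\<forall>a b. \<phi> (a * b) = \<phi> a * \<phi> b) \<and>
       (\<forall>r a. \<phi> (r *\<^sub>R a) = r *\<^sub>R \<phi> a) \<and> (\<forall>a. norm (\<phi> a) = norm a)"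
    by (intro exI[of _ complex_of_real]) (auto simp: scaleR_conv_of_real)
qed

instance complex :: real_or_complex_field
  proof
  show "\<exists>\<phi> :: complex \<Rightarrow> complex.
       (\<forall>a b. \<phi> (a + b) = \<phi> a + \<phi> b) \<and> (\<forall>a b. \<phi> (a * b) = \<phi> a * \<phi> b) \<and>
       (\<forall>r a. \<phi> (r *\<^sub>R a) = r *\<^sub>R \<phi> a) \<and> (\<forall>a. norm (\<phi> a) = norm a)"
    by (intro exI[of _ "\<lambda>z. z"]) blast
qed

text \<open>
  A Banach space over \<open>'k\<close> is a real Banach space whose real scalar multiplication and norm
  are those of a \<open>'k\<close>-vector space structure \<open>scale\<close>.
\<close>

locale scalar_banach = vector_space scale
  for scale :: "'k::real_or_complex_field \<Rightarrow> 'a::banach \<Rightarrow> 'a" +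
  assumes scale_of_real: "scale (of_real r) x = r *\<^sub>R x"
    and norm_scale: "norm (scale c x) = norm c * norm x"

lemma scalar_banach_real: "scalar_banach ((*\<^sub>R) :: real \<Rightarrow> 'a::banach \<Rightarrow> 'a)"
  by (intro scalar_banach.intro real_vector.vector_space_axioms scalar_banach_axioms.intro) simp_all

lemma scalar_banach_complex: "scalar_banach ((*) :: complex \<Rightarrow> complex \<Rightarrow> complex)"
  by (intro scalar_banach.intro vector_space_over_itself.vector_space_axioms scalar_banach_axioms.intro)
    (simp_all add: scaleR_conv_of_real norm_mult)

text \<open>
  Elements of the library type \<open>'a \<Rightarrow>\<^sub>L 'b\<close> are only real-linear, so \<open>\<L>(X,Y)\<close> is the subspace
  of those that are linear over \<open>'k\<close>; its norm is the operator norm of that type.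
\<close>

definition operators ::
  "('k::real_or_complex_field \<Rightarrow> 'a::banach \<Rightarrow> 'a) \<Rightarrow> ('k \<Rightarrow> 'b::real_normed_vector \<Rightarrow> 'b)
    \<Rightarrow> ('a \<Rightarrow>\<^sub>L 'b) set" where
  "operators sX sY = {T. Vector_Spaces.linear sX sY (blinfun_apply T)}"

definition isometry_group ::
  "('k::real_or_complex_field \<Rightarrow> 'a::banach \<Rightarrow> 'a) \<Rightarrow> ('a \<Rightarrow>\<^sub>L 'a) set \<Rightarrow> bool" where
  "isometry_group sX G \<longleftrightarrow>
     (\<forall>g\<in>G. g \<in> operators sX sX \<and> surj (blinfun_apply g) \<and> (\<forall>x. norm (g x) = norm x)) \<and>
     id_blinfun \<in> G \<and>
     (\<forall>g\<in>G. \<forall>h\<in>G. g o\<^sub>L h \<in> G) \<and>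
     (\<forall>g\<in>G. \<exists>h\<in>G. g o\<^sub>L h = id_blinfun \<and> h o\<^sub>L g = id_blinfun)"

definition invariant :: "('a::real_normed_vector \<Rightarrow>\<^sub>L 'a) set \<Rightarrow> ('a \<Rightarrow>\<^sub>L 'b::real_normed_vector) \<Rightarrow> bool"
  where "invariant G T \<longleftrightarrow> (\<forall>g\<in>G. \<forall>x. T (g x) = T x)"

definition norm_attaining :: "('a::real_normed_vector \<Rightarrow>\<^sub>L 'b::real_normed_vector) \<Rightarrow> bool" where
  "norm_attaining T \<longleftrightarrow> (\<exists>x\<in>cball 0 1. norm (T x) = norm T)"

definition invariant_operators ::
  "('k::real_or_complex_field \<Rightarrow> 'a::banach \<Rightarrow> 'a) \<Rightarrow> ('k \<Rightarrow> 'b::banach \<Rightarrow> 'b)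
    \<Rightarrow> ('a \<Rightarrow>\<^sub>L 'a) set \<Rightarrow> ('a \<Rightarrow>\<^sub>L 'b) set" where
  "invariant_operators sX sY G = {T \<in> operators sX sY. invariant G T}"

definition NA_invariant_operators ::
  "('k::real_or_complex_field \<Rightarrow> 'a::banach \<Rightarrow> 'a) \<Rightarrow> ('k \<Rightarrow> 'b::banach \<Rightarrow> 'b)
    \<Rightarrow> ('a \<Rightarrow>\<^sub>L 'a) set \<Rightarrow> ('a \<Rightarrow>\<^sub>L 'b) set" where
  "NA_invariant_operators sX sY G = {T \<in> invariant_operators sX sY G. norm_attaining T}"

definition dual_space :: "('k::real_or_complex_field \<Rightarrow> 'a::banach \<Rightarrow> 'a) \<Rightarrow> ('a \<Rightarrow>\<^sub>L 'k) set" where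
  "dual_space sX = operators sX (*)"

text \<open>
  Since the dual space is a subset of a type, an element of the bidual is a function on that
  whole type, normalised to vanish outside the dual space; this makes functions equal exactly
  when they agree on the dual space. The term \<open>blinfun_mult_right c o\<^sub>L f\<close> is \<open>\<lambda>x. c * f x\<close>.
\<close>

definition bidual_space ::
  "('k::real_or_complex_field \<Rightarrow> 'a::banach \<Rightarrow> 'a) \<Rightarrow> (('a \<Rightarrow>\<^sub>L 'k) \<Rightarrow> 'k) set" where
  "bidual_space sX = {\<Phi>.
     (\<forall>f\<in>dual_space sX. \<forall>h\<in>dual_space sX. \<Phi> (f + h) = \<Phi> f + \<Phi> h) \<and>
     (\<forall>c. \<forall>f\<in>dual_space sX. \<Phi> (blinfun_mult_right c o\<^sub>L f) = c * \<Phi> f) \<and>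
     (\<exists>M. \<forall>f\<in>dual_space sX. norm (\<Phi> f) \<le> M * norm f) \<and>
     (\<forall>f. f \<notin> dual_space sX \<longrightarrow> \<Phi> f = 0)}"

definition bidual_norm ::
  "('k::real_or_complex_field \<Rightarrow> 'a::banach \<Rightarrow> 'a) \<Rightarrow> (('a \<Rightarrow>\<^sub>L 'k) \<Rightarrow> 'k) \<Rightarrow> real" where
  "bidual_norm sX \<Phi> = (SUP f \<in> dual_space sX \<inter> cball 0 1. norm (\<Phi> f))"

definition bidual_ball ::
  "('k::real_or_complex_field \<Rightarrow> 'a::banach \<Rightarrow> 'a) \<Rightarrow> (('a \<Rightarrow>\<^sub>L 'k) \<Rightarrow> 'k) set" where
  "bidual_ball sX = {\<Phi> \<in> bidual_space sX. bidual_norm sX \<Phi> \<le> 1}"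

definition canonical_embedding ::
  "('k::real_or_complex_field \<Rightarrow> 'a::banach \<Rightarrow> 'a) \<Rightarrow> 'a \<Rightarrow> (('a \<Rightarrow>\<^sub>L 'k) \<Rightarrow> 'k)" where
  "canonical_embedding sX x = (\<lambda>f. if f \<in> dual_space sX then f x else 0)"

text \<open>
  The topology of pointwise convergence; elements of the bidual vanish outside the dual space,
  so on the bidual this is pointwise convergence on the dual space.
\<close>

definition weak_star_topology ::
  "('k::real_or_complex_field \<Rightarrow> 'a::banach \<Rightarrow> 'a) \<Rightarrow> (('a \<Rightarrow>\<^sub>L 'k) \<Rightarrow> 'k) topology" where
  "weak_star_topology sX =
     subtopology (product_topology (\<lambda>_. euclidean) UNIV) (bidual_space sX)"

text \<open>
  Pointwise real vector space structure on functions, which makes \<open>(extreme_point_of)\<close>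
  available in the bidual.
\<close>

instantiation "fun" :: (type, real_vector) real_vector
begin

definition scaleR_fun :: "real \<Rightarrow> ('a \<Rightarrow> 'b) \<Rightarrow> 'a \<Rightarrow> 'b" where
  "scaleR_fun r f = (\<lambda>x. r *\<^sub>R f x)"

instance
  by standard (simp_all add: scaleR_fun_def fun_eq_iff scaleR_add_left scaleR_add_right)

end

definition quasi_alpha_family ::
  "('k::real_or_complex_field \<Rightarrow> 'a::banach \<Rightarrow> 'a) \<Rightarrow> ('a \<Rightarrow>\<^sub>L 'a) set
    \<Rightarrow> 'i set \<Rightarrow> ('i \<Rightarrow> 'a) \<Rightarrow> ('i \<Rightarrow> 'a \<Rightarrow>\<^sub>L 'k) \<Rightarrow> ('a \<Rightarrow> real) \<Rightarrow> bool" where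
  "quasi_alpha_family sX G \<Lambda> x x' \<rho> \<longleftrightarrow>
     x ` \<Lambda> \<subseteq> sphere 0 1 \<and>
     x' ` \<Lambda> \<subseteq> dual_space sX \<inter> sphere 0 1 \<and>
     (\<forall>l\<in>\<Lambda>. invariant G (x' l)) \<and>
     (\<forall>l\<in>\<Lambda>. x' l (x l) = 1) \<and>
     (\<forall>l\<in>\<Lambda>. \<forall>m\<in>\<Lambda>. l \<noteq> m \<longrightarrow> norm (x' l (x m)) \<le> \<rho> (x l) \<and> \<rho> (x l) < 1) \<and>
     (\<forall>e. e extreme_point_of bidual_ball sX \<longrightarrow>
        (\<exists>A t. A \<subseteq> x ` \<Lambda> \<and> norm t = 1 \<and>
           (\<lambda>f. t * e f) \<in> weak_star_topology sX closure_of
             (canonical_embedding sX ` {blinfun_apply g a | g a. g \<in> G \<and> a \<in> A}) \<and>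
           (SUP a\<in>A. \<rho> a) < 1))"

text \<open>
  The index set is taken in \<open>'a\<close>. This is no restriction: the points of a family are pairwise
  distinct, so they can serve as the indices (see the lemma below).
\<close>

definition quasi_alpha ::
  "('k::real_or_complex_field \<Rightarrow> 'a::banach \<Rightarrow> 'a) \<Rightarrow> ('a \<Rightarrow>\<^sub>L 'a) set \<Rightarrow> bool" where
  "quasi_alpha sX G \<longleftrightarrow> (\<exists>(\<Lambda> :: 'a set) x x' \<rho>. quasi_alpha_family sX G \<Lambda> x x' \<rho>)"

lemma quasi_alpha_familyD:
  fixes \<Lambda> :: "'i set"
  assumes "quasi_alpha_family sX G \<Lambda> x x' \<rho>"
  shows "quasi_alpha sX G"
proof -
  have sep: "\<forall>l\<in>\<Lambda>. \<forall>m\<in>\<Lambda>. l \<noteq> m \<longrightarrow> norm (x' l (x m)) \<le> \<rho> (x l) \<and> \<rho> (x l) < 1"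
    and one: "\<forall>l\<in>\<Lambda>. x' l (x l) = 1"
    using assms unfolding quasi_alpha_family_def by blast+
  have inj: "inj_on x \<Lambda>"
  proof (rule inj_onI, rule ccontr)
    fix l m
    assume l: "l \<in> \<Lambda>" and m: "m \<in> \<Lambda>" and eq: "x l = x m" and ne: "l \<noteq> m"
    have "norm (x' l (x m)) < 1"
      using sep l m ne by (meson le_less_trans)
    moreover have "x' l (x m) = 1"
      using one l eq by auto
    ultimately show False by simp
  qed
  have idx: "(\<lambda>a. x' (inv_into \<Lambda> x a)) ` x ` \<Lambda> = x' ` \<Lambda>"
    unfolding image_image using inj by (intro image_cong) (auto simp: inv_into_f_f)
  have inv: "inv_into \<Lambda> x (x l) = l" if "l \<in> \<Lambda>" for l
    using inj that by (rule inv_into_f_f)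
  have "quasi_alpha_family sX G (x ` \<Lambda>) (\<lambda>a. a) (\<lambda>a. x' (inv_into \<Lambda> x a)) \<rho>"
    unfolding quasi_alpha_family_def idx image_ident
  proof (intro conjI)
    show "\<forall>l\<in>x ` \<Lambda>. invariant G (x' (inv_into \<Lambda> x l))"
      using assms by (simp add: quasi_alpha_family_def inv)
    show "\<forall>l\<in>x ` \<Lambda>. x' (inv_into \<Lambda> x l) l = 1"
      using one by (simp add: inv)
    show "\<forall>l\<in>x ` \<Lambda>. \<forall>m\<in>x ` \<Lambda>. l \<noteq> m \<longrightarrow>
        norm (x' (inv_into \<Lambda> x l) m) \<le> \<rho> l \<and> \<rho> l < 1"
    proof (intro ballI impI)
      fix a b
      assume "a \<in> x ` \<Lambda>" "b \<in> x ` \<Lambda>" "a \<noteq> b"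
      then obtain l m where "a = x l" "b = x m" "l \<in> \<Lambda>" "m \<in> \<Lambda>" "l \<noteq> m"
        by blast
      then show "norm (x' (inv_into \<Lambda> x a) b) \<le> \<rho> a \<and> \<rho> a < 1"
        using sep by (simp add: inv)
    qed
  qed (insert assms[unfolded quasi_alpha_family_def], (elim conjE, assumption)+)
  then show ?thesis
    unfolding quasi_alpha_def by blast
qed

end

theory Submission
  imports Defs
begin

text \<open>
  The proof perturbs an invariant operator \<open>T\<close> twice, each time by a small multiple of an
  invariant rank one operator \<open>x \<mapsto> f x \<cdot> v\<close>, where \<open>f\<close> is an invariant functional.

  The first perturbation makes the adjoint attain its norm: there is \<open>y\<close> in the dual ball of \<open>Y\<close>
  with \<open>\<parallel>y \<circ> T\<parallel> = \<parallel>T\<parallel>\<close>. Invariance survives because the functionals used have the form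
  \<open>f = y\<^sub>0 \<circ> T\<close>, which is invariant as soon as \<open>T\<close> is. Let \<open>U\<^sub>\<epsilon>\<close> consist of the operators \<open>T\<close> for
  which some point \<open>x\<close> of the unit ball satisfies \<open>\<bar>y (T x)\<bar> > \<parallel>T\<parallel> - \<epsilon>\<close>, uniformly, for all \<open>y\<close> that
  almost attain the norm of the adjoint. The set \<open>U\<^sub>\<epsilon>\<close> is open, and it is dense because
  \<open>T + \<eta> (y\<^sub>0 \<circ> T) \<otimes> T x\<close> lies in it when \<open>x\<close> almost attains the norm of \<open>T\<close> and \<open>y\<^sub>0\<close> norms
  \<open>T x\<close>: an operator so enlarged in the direction \<open>T x\<close> can be almost normed only by functionals
  that almost norm \<open>T x\<close>. By Baire's theorem the intersection of all \<open>U\<^sub>\<epsilon>\<close> is dense, and for an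
  operator in it the conditions \<open>\<bar>y (T x\<^sub>n)\<bar> \<ge> \<parallel>T\<parallel> - 1/n\<close> have, by weak-star compactness, a common
  solution \<open>y\<close>.

  The second step uses the property of \<open>X\<close>. The functional \<open>f = y \<circ> T\<close> is weak-star continuous on
  the compact convex bidual ball, so it attains its norm at an extreme point. Hence there is a
  subset \<open>A\<close> of the family with \<open>r = sup \<rho>(A) < 1\<close> on which \<open>\<bar>f\<bar>\<close> comes arbitrarily close to
  \<open>\<parallel>f\<parallel> = \<parallel>T\<parallel>\<close>; the group disappears since \<open>f\<close> is invariant. Take \<open>x\<^sub>l \<in> A\<close> with \<open>\<parallel>T x\<^sub>l\<parallel>\<close> close to
  \<open>\<parallel>T\<parallel>\<close> and put \<open>S = T + \<eta> x\<^sub>l* \<otimes> T x\<^sub>l\<close>. Then \<open>\<parallel>S x\<^sub>l\<parallel> = (1 + \<eta>) \<parallel>T x\<^sub>l\<parallel>\<close>, whereas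
  \<open>\<parallel>S x\<^sub>m\<parallel> \<le> (1 + \<eta> r) \<parallel>T\<parallel>\<close> for the other members. The same extreme point argument
  shows that the norm of every invariant operator is its supremum over the family, so \<open>S\<close> attains
  its norm at \<open>x\<^sub>l\<close>. It matters that \<open>f\<close> attains its norm at an extreme point and does not merely
  come close to it: \<open>r\<close> has to be known before the required closeness of \<open>\<parallel>T x\<^sub>l\<parallel>\<close> is chosen.

  The classical tools needed on the way are the Hahn-Banach theorem, obtained from minimal sublinear
  functionals, and the existence of extreme points of compact convex sets, obtained from minimal
  closed faces.
\<close>

section \<open>The scalar field\<close>

definition scalar_embedding :: "'k::real_or_complex_field \<Rightarrow> complex" where
  "scalar_embedding = (SOME \<phi>.
     (\<forall>a b. \<phi> (a + b) = \<phi> a + \<phi> b) \<and> (\<forall>a b. \<phi> (a * b) = \<phi> a * \<phi> b) \<and>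
     (\<forall>r a. \<phi> (r *\<^sub>R a) = r *\<^sub>R \<phi> a) \<and> (\<forall>a. norm (\<phi> a) = norm a))"

text \<open>
  The real part that \<open>\<complex>\<close> induces on the scalar field. It links real-linear functionals, for which
  order arguments are available, with functionals over the field.
\<close>

definition real_part :: "'k::real_or_complex_field \<Rightarrow> real" where
  "real_part c = Re (scalar_embedding c)"

lemma scalar_embedding:
  fixes a b :: "'a::real_or_complex_field"
  shows scalar_embedding_add: "scalar_embedding (a + b) = scalar_embedding a + scalar_embedding b"
    and scalar_embedding_mult: "scalar_embedding (a * b) = scalar_embedding a * scalar_embedding b"
    and scalar_embedding_scaleR: "scalar_embedding (r *\<^sub>R a) = r *\<^sub>R scalar_embedding a"
    and norm_scalar_embedding: "norm (scalar_embedding a) = norm a"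
  using someI_ex[OF ex_complex_embedding[where 'a = 'a]]
  by (simp_all only: scalar_embedding_def)

lemma linear_scalar_embedding: "linear scalar_embedding"
  by (intro linearI scalar_embedding_add scalar_embedding_scaleR)

lemma scalar_embedding_diff: "scalar_embedding (a - b) = scalar_embedding a - scalar_embedding b"
  by (rule linear_diff[OF linear_scalar_embedding])

lemma inj_scalar_embedding: "inj scalar_embedding"
proof (rule injI)
  fix a b :: 'a
  assume "scalar_embedding a = scalar_embedding b"
  then have "norm (scalar_embedding (a - b)) = 0"
    by (simp add: scalar_embedding_diff)
  then show "a = b"
    by (simp add: norm_scalar_embedding)
qed

lemma scalar_embedding_one: "scalar_embedding (1::'a::real_or_complex_field) = 1"
proof -
  have "scalar_embedding (1::'a) * scalar_embedding (1::'a) = scalar_embedding (1::'a)"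
    using scalar_embedding_mult[of 1 "1::'a"] by simp
  moreover have "scalar_embedding (1::'a) \<noteq> 0"
    using norm_scalar_embedding[of "1::'a"] by auto
  ultimately show ?thesis by simp
qed

lemma scalar_embedding_of_real: "scalar_embedding (of_real r) = of_real r"
  by (simp add: of_real_def scalar_embedding_scaleR scalar_embedding_one)

lemma bounded_linear_real_part: "bounded_linear real_part"
proof (rule bounded_linear_intro[where K = 1])
  fix c :: 'a
  show "norm (real_part c) \<le> norm c * 1"
    using abs_Re_le_cmod[of "scalar_embedding c"]
    by (simp add: real_part_def norm_scalar_embedding)
qed (simp_all add: real_part_def scalar_embedding_add scalar_embedding_scaleR)

lemma real_part_le_norm: "real_part c \<le> norm c"
  using complex_Re_le_cmod[of "scalar_embedding c"]
  by (simp add: real_part_def norm_scalar_embedding)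

lemma real_part_of_real [simp]: "real_part (of_real r) = r"
  by (simp add: real_part_def scalar_embedding_of_real)

text \<open>
  In the second case \<open>i\<close> is the imaginary unit, and \<open>- real_part (c * i)\<close> is the imaginary part
  of \<open>c\<close>.
\<close>

lemma scalar_field_cases:
  obtains (real) "\<And>c :: 'k::real_or_complex_field. c = of_real (real_part c)"
  | (complex) i :: "'k::real_or_complex_field" where "i * i = - 1" "real_part i = 0"
      "\<And>c. c = of_real (real_part c) - of_real (real_part (c * i)) * i"
proof (cases "\<forall>c :: 'k. c = of_real (real_part c)")
  case True
  then show ?thesis using real by blast
next
  case False
  then obtain c0 :: 'k where c0: "c0 \<noteq> of_real (real_part c0)" by blast
  define b where "b = Im (scalar_embedding c0)"
  have emb: "scalar_embedding (c0 - of_real (real_part c0)) = of_real b * \<i>"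
    by (simp add: scalar_embedding_diff scalar_embedding_of_real real_part_def b_def complex_eq_iff)
  have b: "b \<noteq> 0"
    using c0 emb norm_scalar_embedding[of "c0 - of_real (real_part c0)"] by auto
  define i where "i = (1 / b) *\<^sub>R (c0 - of_real (real_part c0))"
  have i: "scalar_embedding i = \<i>"
    unfolding i_def scalar_embedding_scaleR emb using b by (simp add: scaleR_conv_of_real)
  show ?thesis
  proof (rule complex)
    have "scalar_embedding (i * i) = scalar_embedding (of_real (- 1))"
      by (simp only: scalar_embedding_mult i scalar_embedding_of_real) simp
    then show "i * i = - 1"
      using inj_scalar_embedding by (auto dest: injD)
    show "real_part i = 0"
      by (simp add: real_part_def i)
    show "c = of_real (real_part c) - of_real (real_part (c * i)) * i" for c
      by (rule injD[OF inj_scalar_embedding])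
        (simp add: scalar_embedding_add scalar_embedding_diff scalar_embedding_mult scalar_embedding_of_real i
          real_part_def complex_eq_iff)
  qed
qed

text \<open>
  The field embeds isometrically onto a real subspace of \<open>\<complex>\<close>, which is closed by finite dimension.
\<close>

lemma compact_cball_scalar: "compact (cball (0::'k::real_or_complex_field) r)"
proof -
  define \<psi> :: "complex \<Rightarrow> 'k" where "\<psi> = the_inv scalar_embedding"
  have \<psi>: "\<psi> (scalar_embedding c) = c" for c
    unfolding \<psi>_def by (rule the_inv_f_f[OF inj_scalar_embedding])
  let ?R = "range (scalar_embedding :: 'k \<Rightarrow> complex)"
  have "closed ?R"
    by (intro closed_subspace linear_subspace_image[OF linear_scalar_embedding] subspace_UNIV)
  then have "compact (?R \<inter> cball 0 r)"
    by (intro closed_Int_compact) auto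
  moreover have "continuous_on (?R \<inter> cball 0 r) \<psi>"
    unfolding continuous_on_iff
  proof (intro ballI allI impI)
    fix z and e :: real
    assume z: "z \<in> ?R \<inter> cball 0 r" and "0 < e"
    moreover have "dist (\<psi> w) (\<psi> z) = dist w z" if "w \<in> ?R" for w
      using that z by (auto simp: \<psi> dist_norm norm_scalar_embedding simp flip: scalar_embedding_diff)
    ultimately show "\<exists>d>0. \<forall>w\<in>?R \<inter> cball 0 r. dist w z < d \<longrightarrow> dist (\<psi> w) (\<psi> z) < e"
      by (intro exI[of _ e]) simp
  qed
  ultimately have "compact (\<psi> ` (?R \<inter> cball 0 r))"
    by (rule compact_continuous_image[rotated])
  moreover have "\<psi> ` (?R \<inter> cball 0 r) = cball 0 r"
  proof (intro equalityI subsetI)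
    fix c :: 'k
    assume "c \<in> cball 0 r"
    then have "c = \<psi> (scalar_embedding c)" "scalar_embedding c \<in> ?R \<inter> cball 0 r"
      by (simp_all add: \<psi> norm_scalar_embedding)
    then show "c \<in> \<psi> ` (?R \<inter> cball 0 r)" by (rule image_eqI)
  qed (auto simp: \<psi> norm_scalar_embedding)
  ultimately show ?thesis by simp
qed

section \<open>The Hahn-Banach theorem\<close>

text \<open>
  Only one inequality is required for positive multiples: applying it to \<open>t\<close> and to \<open>1 / t\<close> gives
  positive homogeneity. This makes sublinearity easier to verify for infima.
\<close>

definition sublinear :: "('a::real_vector \<Rightarrow> real) \<Rightarrow> bool" where
  "sublinear p \<longleftrightarrow> (\<forall>x y. p (x + y) \<le> p x + p y) \<and> (\<forall>t>0. \<forall>x. p (t *\<^sub>R x) \<le> t * p x)"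

lemma sublinear_add: "sublinear p \<Longrightarrow> p (x + y) \<le> p x + p y"
  by (simp add: sublinear_def)

lemma sublinear_zero: "sublinear p \<Longrightarrow> p 0 = 0"
proof -
  assume p: "sublinear p"
  have "p ((1/2) *\<^sub>R 0) \<le> (1/2) * p 0" "p (2 *\<^sub>R 0) \<le> 2 * p 0"
    using p unfolding sublinear_def by (blast intro: half_gt_zero zero_less_numeral zero_less_divide_1_iff[THEN iffD2])+
  then show ?thesis by simp
qed

lemma sublinear_scaleR:
  assumes p: "sublinear p" and t: "t \<ge> 0"
  shows "p (t *\<^sub>R x) = t * p x"
proof (cases "t = 0")
  case True
  then show ?thesis using sublinear_zero[OF p] by simp
next
  case False
  then have t: "t > 0" using t by simp
  have "p ((1/t) *\<^sub>R (t *\<^sub>R x)) \<le> (1/t) * p (t *\<^sub>R x)"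
    using p t unfolding sublinear_def by (metis zero_less_divide_1_iff)
  then have "t * p x \<le> p (t *\<^sub>R x)"
    using t by (simp add: field_simps)
  moreover have "p (t *\<^sub>R x) \<le> t * p x"
    using p t unfolding sublinear_def by blast
  ultimately show ?thesis by simp
qed

lemma sublinear_ge_minus: "sublinear p \<Longrightarrow> - p (- x) \<le> p x"
  using sublinear_add[of p x "- x"] sublinear_zero[of p] by simp

text \<open>
  The function \<open>q x = inf {p (x + t a) - t p a | t \<ge> 0}\<close> is the largest sublinear function below \<open>p\<close>
  with \<open>q (- a) \<le> - p a\<close>. It serves twice: it forces a functional below it to agree with
  \<open>p\<close> at \<open>a\<close>, and it shows that minimal sublinear functions are additive.
\<close>

lemma sublinear_shift:
  fixes p :: "'a::real_vector \<Rightarrow> real"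
  assumes p: "sublinear p"
  obtains q where "sublinear q" "\<And>x. q x \<le> p x" "\<And>x. q x \<le> p (x + a) - p a"
proof -
  define q where "q x = (INF t\<in>{0..}. p (x + t *\<^sub>R a) - t * p a)" for x
  have bdd: "bdd_below ((\<lambda>t. p (x + t *\<^sub>R a) - t * p a) ` {0..})" for x
  proof (rule bdd_belowI2)
    fix t :: real
    assume "t \<in> {0..}"
    then have "t * p a \<le> p (x + t *\<^sub>R a) + p (- x)"
      using sublinear_add[OF p, of "x + t *\<^sub>R a" "- x"] sublinear_scaleR[OF p, of t a] by simp
    then show "- p (- x) \<le> p (x + t *\<^sub>R a) - t * p a" by simp
  qed
  have le: "q x \<le> p (x + t *\<^sub>R a) - t * p a" if "t \<ge> 0" for x t
    unfolding q_def using that by (intro cINF_lower[OF bdd]) simp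
  have ge: "c \<le> q x" if "\<And>t. t \<ge> 0 \<Longrightarrow> c \<le> p (x + t *\<^sub>R a) - t * p a" for c x
    unfolding q_def using that by (intro cINF_greatest) auto
  have "sublinear q"
    unfolding sublinear_def
  proof (intro conjI allI impI)
    fix x y
    have sum: "q (x + y) \<le> (p (x + s *\<^sub>R a) - s * p a) + (p (y + t *\<^sub>R a) - t * p a)"
      if "s \<ge> 0" "t \<ge> 0" for s t
      using le[of "s + t" "x + y"] sublinear_add[OF p, of "x + s *\<^sub>R a" "y + t *\<^sub>R a"] that
      by (simp add: algebra_simps)
    have "q (x + y) - (p (x + s *\<^sub>R a) - s * p a) \<le> q y" if "s \<ge> 0" for s
      using sum[OF that] by (intro ge) (simp add: algebra_simps)
    then have "q (x + y) - q y \<le> q x"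
      by (intro ge) (simp add: algebra_simps)
    then show "q (x + y) \<le> q x + q y" by simp
  next
    fix c :: real and x
    assume c: "c > 0"
    have "q (c *\<^sub>R x) \<le> c * (p (x + t *\<^sub>R a) - t * p a)" if "t \<ge> 0" for t
      using le[of "c * t" "c *\<^sub>R x"] sublinear_scaleR[OF p, of c "x + t *\<^sub>R a"] c that
      by (simp add: algebra_simps)
    then have "q (c *\<^sub>R x) / c \<le> q x"
      using c by (intro ge) (simp add: field_simps)
    then show "q (c *\<^sub>R x) \<le> c * q x"
      using c by (simp add: field_simps)
  qed
  moreover have "q x \<le> p x" for x
    using le[of 0 x] by simp
  moreover have "q x \<le> p (x + a) - p a" for x
    using le[of 1 x] by simp
  ultimately show ?thesis by (rule that)
qed

text \<open>
  Zorn's lemma applies because the pointwise infimum of a chain is sublinear; it is finite since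
  \<open>q x \<ge> - q (- x) \<ge> - p (- x)\<close> for every sublinear \<open>q\<close> below \<open>p\<close>.
\<close>

lemma minimal_sublinear_exists:
  fixes p :: "'a::real_vector \<Rightarrow> real"
  assumes p: "sublinear p"
  obtains q where "sublinear q" "q \<le> p" "\<And>r. sublinear r \<Longrightarrow> r \<le> q \<Longrightarrow> r = q"
proof -
  define S where "S = {q. sublinear q \<and> q \<le> p}"
  define P :: "('a \<Rightarrow> real) \<Rightarrow> ('a \<Rightarrow> real) \<Rightarrow> bool" where "P = (\<lambda>f g. g \<le> f)"
  have "\<exists>m\<in>S. \<forall>a\<in>S. P m a \<longrightarrow> a = m"
  proof (rule predicate_Zorn)
    show "partial_order_on S (relation_of P S)"
      unfolding P_def by (intro partial_order_on_relation_ofI) auto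
  next
    fix C
    assume "C \<in> Chains (relation_of P S)"
    then have CS: "C \<subseteq> S" and chain: "\<And>f g. f \<in> C \<Longrightarrow> g \<in> C \<Longrightarrow> f \<le> g \<or> g \<le> f"
      unfolding Chains_def relation_of_def P_def by blast+
    show "\<exists>u\<in>S. \<forall>a\<in>C. P a u"
    proof (cases "C = {}")
      case True
      then show ?thesis using p by (auto simp: S_def)
    next
      case False
      define u where "u x = (INF q\<in>C. q x)" for x
      have bdd: "bdd_below ((\<lambda>q. q x) ` C)" for x
      proof (rule bdd_belowI2)
        fix q
        assume "q \<in> C"
        then have "sublinear q" "q (- x) \<le> p (- x)" using CS by (auto simp: S_def le_fun_def)
        then show "- p (- x) \<le> q x" using sublinear_ge_minus[of q x] by simp
      qed
      have le: "u x \<le> q x" if "q \<in> C" for x q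
        unfolding u_def using that by (intro cINF_lower[OF bdd])
      have ge: "c \<le> u x" if "\<And>q. q \<in> C \<Longrightarrow> c \<le> q x" for c x
        unfolding u_def using that False by (intro cINF_greatest)
      have sub: "sublinear q" if "q \<in> C" for q
        using CS that by (auto simp: S_def)
      have "sublinear u"
        unfolding sublinear_def
      proof (intro conjI allI impI)
        fix x y
        have sum: "u (x + y) \<le> f x + g y" if f: "f \<in> C" and g: "g \<in> C" for f g
        proof -
          \<comment> \<open>subadditivity of the smaller of the two members suffices\<close>
          obtain h where h: "h \<in> C" "h \<le> f" "h \<le> g"
            using chain[OF f g] f g by blast
          then show ?thesis
            using le[OF h(1), of "x + y"] sublinear_add[OF sub[OF h(1)], of x y]
            by (smt (verit) le_funD)
        qed
        have "u (x + y) - f x \<le> u y" if "f \<in> C" for f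
          using sum[OF that] by (intro ge) (simp add: algebra_simps)
        then have "u (x + y) - u y \<le> u x"
          by (intro ge) (simp add: algebra_simps)
        then show "u (x + y) \<le> u x + u y" by simp
      next
        fix t :: real and x
        assume t: "t > 0"
        have "u (t *\<^sub>R x) / t \<le> u x"
        proof (rule ge)
          fix q assume q: "q \<in> C"
          then show "u (t *\<^sub>R x) / t \<le> q x"
            using le[OF q, of "t *\<^sub>R x"] sublinear_scaleR[OF sub[OF q], of t x] t
            by (simp add: field_simps)
        qed
        then show "u (t *\<^sub>R x) \<le> t * u x"
          using t by (simp add: field_simps)
      qed
      moreover have "u \<le> q" if "q \<in> C" for q
        using le[OF that] by (simp add: le_fun_def)
      moreover have "u \<le> p"
        using False CS calculation(2) by (force simp: S_def)
      ultimately show ?thesis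
        by (auto simp: S_def P_def)
    qed
  qed
  then obtain q where "q \<in> S" "\<And>r. r \<in> S \<Longrightarrow> r \<le> q \<Longrightarrow> r = q"
    by (auto simp: P_def)
  then show ?thesis
    using that[of q] by (auto simp: S_def)
qed

text \<open>
  Minimality makes \<open>q\<close> equal to its own shift in every direction \<open>a\<close>, so
  \<open>q x \<le> q (x + a) - q a\<close>, which is the inequality opposite to subadditivity.
\<close>

lemma minimal_sublinear_linear:
  fixes q :: "'a::real_vector \<Rightarrow> real"
  assumes q: "sublinear q" and min: "\<And>r. sublinear r \<Longrightarrow> r \<le> q \<Longrightarrow> r = q"
  shows "linear q"
proof -
  have add: "q (x + a) = q x + q a" for x a
  proof -
    obtain r where "sublinear r" "\<And>x. r x \<le> q x" "\<And>x. r x \<le> q (x + a) - q a"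
      using sublinear_shift[OF q] by blast
    with min[of r] have "q x \<le> q (x + a) - q a"
      by (simp add: le_fun_def)
    with sublinear_add[OF q, of x a] show ?thesis by simp
  qed
  have neg: "q (- x) = - q x" for x
    using add[of x "- x"] sublinear_zero[OF q] by simp
  have "q (t *\<^sub>R x) = t * q x" for t x
    using sublinear_scaleR[OF q, of t x] sublinear_scaleR[OF q, of "- t" x] neg[of "t *\<^sub>R x"]
    by (cases "t \<ge> 0") auto
  with add show ?thesis
    by (intro linearI) auto
qed

lemma hahn_banach_sublinear:
  fixes p :: "'a::real_vector \<Rightarrow> real"
  assumes p: "sublinear p"
  obtains u where "linear u" "\<And>x. u x \<le> p x" "u a = p a"
proof -
  obtain q where q: "sublinear q" "\<And>x. q x \<le> p x" "\<And>x. q x \<le> p (x + a) - p a"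
    using sublinear_shift[OF p] by blast
  obtain u where u: "sublinear u" "u \<le> q" "\<And>r. sublinear r \<Longrightarrow> r \<le> u \<Longrightarrow> r = u"
    using minimal_sublinear_exists[OF q(1)] by blast
  have lin: "linear u"
    using u by (intro minimal_sublinear_linear)
  have le: "u x \<le> p x" for x
    using u(2) q(2)[of x] by (auto simp: le_fun_def intro: order_trans)
  have "u (- a) \<le> p (- a + a) - p a"
    using u(2) q(3)[of "- a"] by (auto simp: le_fun_def intro: order_trans)
  then have "p a \<le> u a"
    using sublinear_zero[OF p] linear_neg[OF lin, of a] by simp
  with le[of a] have "u a = p a" by simp
  with lin le show ?thesis by (rule that)
qed

lemma operators_iff:
  "T \<in> operators sX sY \<longleftrightarrow> vector_space sX \<and> vector_space sY \<and> (\<forall>c x. T (sX c x) = sY c (T x))"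
  by (auto simp: operators_def Vector_Spaces.linear_iff blinfun.add_right)

lemma vector_space_mult: "vector_space ((*) :: 'k::field \<Rightarrow> 'k \<Rightarrow> 'k)"
  by (rule vector_space_over_itself.vector_space_axioms)

lemma (in scalar_banach) dual_space_iff: "f \<in> dual_space scale \<longleftrightarrow> (\<forall>c x. f (scale c x) = c * f x)"
  by (simp add: dual_space_def operators_iff vector_space_mult vector_space_axioms)

text \<open>
  A real-linear \<open>u\<close> is the real part of the functional \<open>u x - u (i x) i\<close> in the complex case, and
  of itself in the real case.
\<close>

lemma (in scalar_banach) hahn_banach_norming:
  obtains f where "f \<in> dual_space scale" "norm f \<le> 1" "f y = of_real (norm y)"
proof -
  have "sublinear (norm :: 'a \<Rightarrow> real)"
    by (simp add: sublinear_def norm_triangle_ineq)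
  then obtain u where u: "linear u" "\<And>x. u x \<le> norm x" "u y = norm y"
    using hahn_banach_sublinear[of norm y] by blast
  have uadd: "u (x + z) = u x + u z" and uscale: "u (r *\<^sub>R x) = r * u x" for x z r
    using linear_add[OF u(1)] linear_scale[OF u(1)] by auto
  \<comment> \<open>a functional whose real part is \<open>u\<close> inherits the bound on \<open>u\<close>, by a rotation of the argument\<close>
  have bound: "norm (F x) \<le> norm x"
    if F: "\<And>c x. F (scale c x) = c * F x" "\<And>x. real_part (F x) = u x" for F x
  proof (cases "F x = 0")
    case False
    define d where "d = of_real (norm (F x)) / F x"
    have "norm d = 1"
      using False by (simp add: d_def norm_divide)
    have "F (scale d x) = of_real (norm (F x))"
      using False by (simp add: F d_def)
    then have "norm (F x) = u (scale d x)"
      using F(2)[of "scale d x"] by simp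
    also have "\<dots> \<le> norm (scale d x)" by (rule u)
    also have "\<dots> = norm x" by (simp add: norm_scale \<open>norm d = 1\<close>)
    finally show ?thesis .
  qed simp
  have "\<exists>F. (\<forall>x z. F (x + z) = F x + F z) \<and> (\<forall>c x. F (scale c x) = c * F x) \<and>
          (\<forall>x. real_part (F x) = u x)"
  proof (cases rule: scalar_field_cases[where 'k = 'k])
    case real
    have "u (scale c x) = real_part c * u x" for c x
      using scale_of_real[of "real_part c" x] uscale by (simp flip: real)
    then have "of_real (u (scale c x)) = c * of_real (u x)" for c x
      using real[of c] by (metis of_real_mult)
    then show ?thesis
      by (intro exI[of _ "\<lambda>x. of_real (u x)"]) (simp add: uadd)
  next
    case (complex i)
    define F where "F x = of_real (u x) - of_real (u (scale i x)) * i" for x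
    have F_add: "F (x + z) = F x + F z" for x z
      by (simp add: F_def uadd scale_right_distrib algebra_simps)
    have i_comm: "scale i (r *\<^sub>R x) = r *\<^sub>R scale i x" for r x
      by (simp add: mult.commute flip: scale_of_real)
    have F_real: "F (r *\<^sub>R x) = of_real r * F x" for r x
      by (simp add: F_def uscale i_comm algebra_simps)
    have ii: "scale i (scale i x) = - x" for x
      by (simp add: complex(1) scale_minus_left)
    have F_i: "F (scale i x) = i * F x" for x
      using complex(1) by (simp add: F_def ii linear_neg[OF u(1)] algebra_simps flip: mult.assoc)
    have F_scale: "F (scale c x) = c * F x" for c x
    proof -
      let ?a = "real_part c" and ?b = "- real_part (c * i)"
      have c: "c = of_real ?a + of_real ?b * i"
        using complex(3)[of c] by simp
      have "scale c x = scale (of_real ?a + of_real ?b * i) x"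
        using c by simp
      also have "\<dots> = ?a *\<^sub>R x + ?b *\<^sub>R scale i x"
        by (simp only: scale_left_distrib scale_of_real scale_scale[symmetric])
      finally have "F (scale c x) = (of_real ?a + of_real ?b * i) * F x"
        by (simp only: F_add F_real F_i) (simp add: algebra_simps)
      with c show ?thesis by simp
    qed
    have "real_part (F x) = u x" for x
    proof -
      interpret bounded_linear "real_part :: 'k \<Rightarrow> real" by (rule bounded_linear_real_part)
      have "of_real r * i = r *\<^sub>R i" for r by (simp add: scaleR_conv_of_real)
      then show ?thesis by (simp add: F_def diff scaleR complex)
    qed
    with F_add F_scale show ?thesis by blast
  qed
  then obtain F where F: "\<And>x z. F (x + z) = F x + F z" "\<And>c x. F (scale c x) = c * F x"
      "\<And>x. real_part (F x) = u x" by blast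
  have bF: "norm (F x) \<le> norm x" for x
    by (rule bound[OF F(2,3)])
  have bl: "bounded_linear F"
  proof (rule bounded_linear_intro[where K = 1])
    show "F (r *\<^sub>R x) = r *\<^sub>R F x" for r x
      using F(2)[of "of_real r" x] by (simp add: scale_of_real scaleR_conv_of_real)
  qed (simp_all add: F bF)
  have ap: "blinfun_apply (Blinfun F) = F"
    by (rule bounded_linear_Blinfun_apply[OF bl])
  show ?thesis
  proof (rule that[of "Blinfun F"])
    show "Blinfun F \<in> dual_space scale"
      by (simp add: dual_space_iff ap F)
    show "norm (Blinfun F) \<le> 1"
      by (rule norm_blinfun_bound) (simp_all add: ap bF)
    \<comment> \<open>\<open>F y\<close> has modulus at most \<open>norm y\<close> and real part \<open>norm y\<close>\<close>
    have re: "Re (scalar_embedding (F y)) = norm y"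
      using F(3)[of y] u(3) by (simp add: real_part_def)
    have "cmod (scalar_embedding (F y)) \<le> norm y"
      using bF[of y] by (simp add: norm_scalar_embedding)
    then have "(Re (scalar_embedding (F y)))\<^sup>2 + (Im (scalar_embedding (F y)))\<^sup>2 \<le> (norm y)\<^sup>2"
      using power_mono[of "cmod (scalar_embedding (F y))" "norm y" 2] by (simp add: cmod_power2)
    then have "Im (scalar_embedding (F y)) = 0"
      using re by simp
    then have "scalar_embedding (F y) = scalar_embedding (of_real (norm y))"
      using re by (simp add: complex_eq_iff scalar_embedding_of_real)
    then show "Blinfun F y = of_real (norm y)"
      using ap inj_scalar_embedding by (metis injD)
  qed
qed

section \<open>Extreme points of compact convex sets\<close>

lemma maximizing_face_exists:
  fixes E :: "'v::{real_vector, topological_space} set"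
  assumes "compact K" "closed E" "E \<subseteq> K" "convex E" "E \<noteq> {}"
    and l: "linear l" "continuous_on K (l :: 'v \<Rightarrow> real)"
  obtains E' where "E' face_of E" "closed E'" "E' \<noteq> {}" "E' \<subseteq> E" "\<And>x y. x \<in> E \<Longrightarrow> y \<in> E' \<Longrightarrow> l x \<le> l y"
proof -
  have cont: "continuous_on E l"
    using l(2) \<open>E \<subseteq> K\<close> by (rule continuous_on_subset)
  have "compact E"
    using compact_Int_closed[OF \<open>compact K\<close> \<open>closed E\<close>] \<open>E \<subseteq> K\<close> by (simp add: Int_absorb1)
  then obtain m where m: "m \<in> E" "\<And>x. x \<in> E \<Longrightarrow> l x \<le> l m"
    using continuous_attains_sup[OF _ \<open>E \<noteq> {}\<close> cont] by blast
  let ?E' = "E \<inter> l -` {l m}"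
  have "?E' face_of E"
    unfolding face_of_def
  proof (intro conjI ballI impI)
    show "convex ?E'"
      by (intro convex_Int \<open>convex E\<close> convex_linear_vimage[OF l(1)]) simp
  next
    fix a b y
    assume ab: "a \<in> E" "b \<in> E" and y: "y \<in> ?E'" and seg: "y \<in> open_segment a b"
    obtain u where u: "0 < u" "u < 1" "y = (1 - u) *\<^sub>R a + u *\<^sub>R b"
      using seg by (auto simp: in_segment)
    have "l m = (1 - u) * l a + u * l b"
      using y u(3) by (simp add: linear_add[OF l(1)] linear_scale[OF l(1)])
    then have eq: "(1 - u) * (l m - l a) + u * (l m - l b) = 0"
      by (simp add: algebra_simps)
    have "0 \<le> (1 - u) * (l m - l a)" "0 \<le> u * (l m - l b)"
      using m(2) ab u by simp_all
    with eq have "(1 - u) * (l m - l a) = 0" "u * (l m - l b) = 0"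
      by linarith+
    then show "a \<in> ?E'" "b \<in> ?E'"
      using u ab by simp_all
  qed auto
  moreover have "closed ?E'"
    using cont \<open>closed E\<close> by (rule continuous_closed_preimage) simp
  ultimately show ?thesis
    using m by (intro that[of ?E']) auto
qed

text \<open>
  A minimal closed face inside the face where \<open>l0\<close> is maximal consists of a single point: a
  functional separating two of its points would cut out a smaller face.
\<close>

lemma extreme_point_maximizing_functional:
  fixes K :: "'v::{real_vector, topological_space} set" and L :: "('v \<Rightarrow> real) set"
  assumes K: "compact K" "closed K" "convex K" "K \<noteq> {}"
    and L: "\<And>l. l \<in> L \<Longrightarrow> linear l" "\<And>l. l \<in> L \<Longrightarrow> continuous_on K l"
    and sep: "\<And>x y. x \<in> K \<Longrightarrow> y \<in> K \<Longrightarrow> x \<noteq> y \<Longrightarrow> \<exists>l\<in>L. l x \<noteq> l y"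
    and l0: "l0 \<in> L"
  obtains e where "e extreme_point_of K" "\<And>x. x \<in> K \<Longrightarrow> l0 x \<le> l0 e"
proof -
  obtain E0 where E0: "E0 face_of K" "closed E0" "E0 \<noteq> {}"
      "\<And>x y. x \<in> K \<Longrightarrow> y \<in> E0 \<Longrightarrow> l0 x \<le> l0 y"
    using maximizing_face_exists[OF K(1,2) order_refl K(3,4) L[OF l0]] by metis
  define \<A> where "\<A> = {E. E face_of K \<and> closed E \<and> E \<noteq> {} \<and> E \<subseteq> E0}"
  define P :: "'v set \<Rightarrow> 'v set \<Rightarrow> bool" where "P = (\<lambda>A B. B \<subseteq> A)"
  have "\<exists>m\<in>\<A>. \<forall>E\<in>\<A>. P m E \<longrightarrow> E = m"
  proof (rule predicate_Zorn)
    show "partial_order_on \<A> (relation_of P \<A>)"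
      unfolding P_def by (intro partial_order_on_relation_ofI) auto
  next
    fix C
    assume "C \<in> Chains (relation_of P \<A>)"
    then have CA: "C \<subseteq> \<A>" and chain: "\<And>A B. A \<in> C \<Longrightarrow> B \<in> C \<Longrightarrow> A \<subseteq> B \<or> B \<subseteq> A"
      unfolding Chains_def relation_of_def P_def by blast+
    show "\<exists>u\<in>\<A>. \<forall>a\<in>C. P a u"
    proof (cases "C = {}")
      case True
      then show ?thesis using E0 by (auto simp: \<A>_def)
    next
      case False
      have fin: "\<exists>m\<in>C. m \<subseteq> \<Inter>F" if "finite F" "F \<subseteq> C" for F
        using that
      proof (induction F rule: finite_induct)
        case empty
        then show ?case using False by auto
      next
        case (insert A F)
        then obtain m where "m \<in> C" "m \<subseteq> \<Inter>F" by auto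
        moreover have "A \<in> C" using insert.prems by simp
        ultimately have "A \<subseteq> \<Inter>(insert A F) \<or> m \<subseteq> \<Inter>(insert A F)"
          using chain[of A m] by auto
        with \<open>A \<in> C\<close> \<open>m \<in> C\<close> show ?case by blast
      qed
      have "K \<inter> \<Inter>C \<noteq> {}"
      proof (rule compact_imp_fip[OF K(1)])
        show "closed T" if "T \<in> C" for T
          using that CA by (auto simp: \<A>_def)
        show "K \<inter> \<Inter>F \<noteq> {}" if F: "finite F" "F \<subseteq> C" for F
        proof -
          obtain m where m: "m \<in> C" "m \<subseteq> \<Inter>F"
            using fin[OF F] by blast
          then have "m \<noteq> {}" "m \<subseteq> K"
            using CA face_of_imp_subset unfolding \<A>_def by blast+
          with m show ?thesis by blast
        qed
      qed
      moreover have "\<Inter>C face_of K"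
        using False CA by (intro face_of_Inter) (auto simp: \<A>_def)
      moreover have "closed (\<Inter>C)"
        using CA by (intro closed_Inter) (auto simp: \<A>_def)
      moreover have "\<Inter>C \<subseteq> E0"
        using False CA by (auto simp: \<A>_def)
      ultimately have "\<Inter>C \<in> \<A>"
        by (auto simp: \<A>_def)
      then show ?thesis
        by (auto simp: P_def)
    qed
  qed
  then obtain E where E: "E \<in> \<A>" and min: "\<And>E'. E' \<in> \<A> \<Longrightarrow> E' \<subseteq> E \<Longrightarrow> E' = E"
    by (auto simp: P_def)
  have EK: "E face_of K" "closed E" "E \<noteq> {}" "E \<subseteq> E0"
    using E by (auto simp: \<A>_def)
  have sub: "E \<subseteq> K" and conv: "convex E"
    using EK(1) by (auto dest: face_of_imp_subset face_of_imp_convex)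
  have single: "x = y" if xy: "x \<in> E" "y \<in> E" for x y
  proof (rule ccontr)
    assume "x \<noteq> y"
    then obtain l where l: "l \<in> L" "l x \<noteq> l y"
      using sep xy sub by blast
    obtain E' where E': "E' face_of E" "closed E'" "E' \<noteq> {}" "E' \<subseteq> E"
        "\<And>x y. x \<in> E \<Longrightarrow> y \<in> E' \<Longrightarrow> l x \<le> l y"
      using maximizing_face_exists[OF K(1) EK(2) sub conv EK(3) L[OF l(1)]] by metis
    have "E' \<in> \<A>"
      using E' EK by (auto simp: \<A>_def intro: face_of_trans)
    then have "E' = E"
      using min E'(4) by blast
    then have "l x = l y"
      using E'(5)[of x y] E'(5)[of y x] xy by auto
    with l(2) show False by simp
  qed
  obtain e where "e \<in> E" using EK(3) by blast
  with single have "E = {e}" by blast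
  with EK E0(4) show ?thesis
    by (intro that[of e]) (auto simp: face_of_singleton)
qed

section \<open>Functionals on a space with a quasi-alpha family\<close>

text \<open>
  Tychonoff's theorem; both the dual ball and the bidual ball are closed subsets of such a product.
\<close>

lemma compact_bounded_functions:
  fixes N :: "'v \<Rightarrow> real"
  shows "compact {\<phi> :: 'v \<Rightarrow> 'k::real_or_complex_field. \<forall>v. norm (\<phi> v) \<le> N v}"
proof -
  have "{\<phi> :: 'v \<Rightarrow> 'k. \<forall>v. norm (\<phi> v) \<le> N v} = (\<Pi>\<^sub>E v\<in>UNIV. cball 0 (N v))"
    by (auto simp: PiE_UNIV_domain)
  moreover have "compactin (product_topology (\<lambda>_. euclidean) UNIV) (\<Pi>\<^sub>E v\<in>UNIV. cball (0::'k) (N v))"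
    by (simp add: compactin_PiE compact_cball_scalar)
  ultimately show ?thesis
    by (simp add: euclidean_product_topology)
qed

context scalar_banach
begin

lemma zero_in_dual_space: "0 \<in> dual_space scale"
  by (simp add: dual_space_iff)

lemma add_in_dual_space: "f \<in> dual_space scale \<Longrightarrow> h \<in> dual_space scale \<Longrightarrow> f + h \<in> dual_space scale"
  by (simp add: dual_space_iff blinfun.add_left algebra_simps)

lemma mult_in_dual_space: "f \<in> dual_space scale \<Longrightarrow> blinfun_mult_right c o\<^sub>L f \<in> dual_space scale"
  by (simp add: dual_space_iff algebra_simps)

lemma mult_of_real_blinfun: "blinfun_mult_right (of_real r) o\<^sub>L (f :: 'a \<Rightarrow>\<^sub>L 'k) = r *\<^sub>R f"
  by (rule blinfun_eqI) (simp add: blinfun.scaleR_left scaleR_conv_of_real)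

text \<open>
  Membership in the bidual ball as a conjunction of conditions on finitely many coordinates each, so
  that closedness and convexity can be read off.
\<close>

lemma bidual_ball_iff:
  "\<Phi> \<in> bidual_ball scale \<longleftrightarrow>
     (\<forall>f\<in>dual_space scale. \<forall>h\<in>dual_space scale. \<Phi> (f + h) = \<Phi> f + \<Phi> h) \<and>
     (\<forall>c. \<forall>f\<in>dual_space scale. \<Phi> (blinfun_mult_right c o\<^sub>L f) = c * \<Phi> f) \<and>
     (\<forall>f. norm (\<Phi> f) \<le> (if f \<in> dual_space scale then norm f else 0))"
    (is "?L \<longleftrightarrow> ?R")
proof
  assume ?L
  then have \<Phi>: "\<Phi> \<in> bidual_space scale" and le1: "bidual_norm scale \<Phi> \<le> 1"
    by (auto simp: bidual_ball_def)
  from \<Phi> obtain M where M: "\<And>f. f \<in> dual_space scale \<Longrightarrow> norm (\<Phi> f) \<le> M * norm f"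
    unfolding bidual_space_def by blast
  have hom: "\<Phi> (blinfun_mult_right c o\<^sub>L f) = c * \<Phi> f" if "f \<in> dual_space scale" for c f
    using \<Phi> that by (auto simp: bidual_space_def)
  have bdd: "bdd_above ((\<lambda>f. norm (\<Phi> f)) ` (dual_space scale \<inter> cball 0 1))"
  proof (rule bdd_aboveI2)
    fix f assume f: "f \<in> dual_space scale \<inter> cball 0 1"
    then have "norm (\<Phi> f) \<le> M * norm f" using M by blast
    also have "\<dots> \<le> \<bar>M\<bar> * 1"
      using f by (intro mult_mono) auto
    finally show "norm (\<Phi> f) \<le> \<bar>M\<bar>" by simp
  qed
  have "norm (\<Phi> f) \<le> norm f" if f: "f \<in> dual_space scale" for f
  proof (cases "f = 0")
    case True
    then show ?thesis using M[OF f] by simp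
  next
    case False
    let ?h = "blinfun_mult_right (of_real (1 / norm f)) o\<^sub>L f"
    have "?h \<in> dual_space scale"
      by (rule mult_in_dual_space[OF f])
    moreover have "norm ?h = 1"
      unfolding mult_of_real_blinfun using False by simp
    ultimately have "?h \<in> dual_space scale \<inter> cball 0 1" by simp
    then have "norm (\<Phi> ?h) \<le> bidual_norm scale \<Phi>"
      unfolding bidual_norm_def by (rule cSUP_upper[OF _ bdd])
    with le1 have "norm (\<Phi> ?h) \<le> 1" by simp
    then show ?thesis
      using False by (simp add: hom[OF f] norm_mult norm_divide field_simps)
  qed
  with \<Phi> show ?R by (auto simp: bidual_space_def)
next
  assume R: ?R
  have le: "norm (\<Phi> f) \<le> norm f" if "f \<in> dual_space scale" for f
    using conjunct2[OF conjunct2[OF R], rule_format, of f] that by simp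
  have zero: "\<Phi> f = 0" if "f \<notin> dual_space scale" for f
    using conjunct2[OF conjunct2[OF R], rule_format, of f] that by simp
  have "\<exists>M. \<forall>f\<in>dual_space scale. norm (\<Phi> f) \<le> M * norm f"
    using le by (intro exI[of _ 1]) simp
  with R zero have "\<Phi> \<in> bidual_space scale"
    unfolding bidual_space_def by blast
  moreover have "bidual_norm scale \<Phi> \<le> 1"
    unfolding bidual_norm_def using zero_in_dual_space
    by (intro cSUP_least) (auto intro: order_trans[OF le])
  ultimately show ?L by (simp add: bidual_ball_def)
qed

lemma closed_bidual_ball: "closed (bidual_ball scale)"
proof -
  have "bidual_ball scale = {\<Phi>.
     (\<forall>f. f \<in> dual_space scale \<longrightarrow> (\<forall>h. h \<in> dual_space scale \<longrightarrow> \<Phi> (f + h) = \<Phi> f + \<Phi> h)) \<and>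
     (\<forall>c f. f \<in> dual_space scale \<longrightarrow> \<Phi> (blinfun_mult_right c o\<^sub>L f) = c * \<Phi> f) \<and>
     (\<forall>f. norm (\<Phi> f) \<le> (if f \<in> dual_space scale then norm f else 0))}"
    by (rule set_eqI) (simp only: mem_Collect_eq bidual_ball_iff Ball_def)
  moreover have "closed \<dots>"
    by (intro closed_Collect_conj closed_Collect_all closed_Collect_imp closed_Collect_eq
      closed_Collect_le open_Collect_const continuous_intros continuous_on_product_coordinates)
  ultimately show ?thesis by (simp only:)
qed

lemma compact_bidual_ball: "compact (bidual_ball scale)"
proof -
  let ?B = "{\<phi> :: ('a \<Rightarrow>\<^sub>L 'k) \<Rightarrow> 'k. \<forall>f. norm (\<phi> f) \<le> (if f \<in> dual_space scale then norm f else 0)}"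
  have "bidual_ball scale \<subseteq> ?B"
    unfolding bidual_ball_iff subset_iff mem_Collect_eq by blast
  then have "?B \<inter> bidual_ball scale = bidual_ball scale"
    by (rule Int_absorb1)
  moreover have "compact (?B \<inter> bidual_ball scale)"
    by (rule compact_Int_closed[OF compact_bounded_functions closed_bidual_ball])
  ultimately show ?thesis
    by (simp only:)
qed

lemma convex_bidual_ball: "convex (bidual_ball scale)"
proof (rule convexI)
  fix \<Phi> \<Psi> :: "('a \<Rightarrow>\<^sub>L 'k) \<Rightarrow> 'k" and u v :: real
  assume B: "\<Phi> \<in> bidual_ball scale" "\<Psi> \<in> bidual_ball scale" and uv: "0 \<le> u" "0 \<le> v" "u + v = 1"
  have ap: "(u *\<^sub>R \<Phi> + v *\<^sub>R \<Psi>) f = u *\<^sub>R \<Phi> f + v *\<^sub>R \<Psi> f" for f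
    by (simp add: scaleR_fun_def)
  have "norm (u *\<^sub>R \<Phi> f + v *\<^sub>R \<Psi> f) \<le> (if f \<in> dual_space scale then norm f else 0)" (is "_ \<le> ?N") for f
  proof -
    have "norm (u *\<^sub>R \<Phi> f + v *\<^sub>R \<Psi> f) \<le> u * norm (\<Phi> f) + v * norm (\<Psi> f)"
      using uv norm_triangle_ineq[of "u *\<^sub>R \<Phi> f" "v *\<^sub>R \<Psi> f"] by simp
    also have "\<dots> \<le> u * ?N + v * ?N"
      using B uv by (intro add_mono mult_left_mono) (simp_all only: bidual_ball_iff)
    also have "\<dots> = ?N"
      using uv by (simp flip: distrib_right)
    finally show ?thesis .
  qed
  moreover have "u *\<^sub>R \<Phi> (f + h) + v *\<^sub>R \<Psi> (f + h) = (u *\<^sub>R \<Phi> f + v *\<^sub>R \<Psi> f) + (u *\<^sub>R \<Phi> h + v *\<^sub>R \<Psi> h)"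
    if "f \<in> dual_space scale" "h \<in> dual_space scale" for f h
    using B that by (simp add: bidual_ball_iff scaleR_add_right)
  moreover have "u *\<^sub>R \<Phi> (blinfun_mult_right c o\<^sub>L f) + v *\<^sub>R \<Psi> (blinfun_mult_right c o\<^sub>L f)
      = c * (u *\<^sub>R \<Phi> f + v *\<^sub>R \<Psi> f)"
    if "f \<in> dual_space scale" for c f
    using B that by (simp add: bidual_ball_iff distrib_left)
  ultimately show "u *\<^sub>R \<Phi> + v *\<^sub>R \<Psi> \<in> bidual_ball scale"
    unfolding bidual_ball_iff ap by blast
qed

lemma canonical_embedding_in_bidual_ball:
  assumes "norm x \<le> 1"
  shows "canonical_embedding scale x \<in> bidual_ball scale"
proof -
  have "norm (f x) \<le> norm f" for f :: "'a \<Rightarrow>\<^sub>L 'k"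
    using norm_blinfun[of f x] mult_left_mono[OF assms, of "norm f"] by simp
  then show ?thesis
    unfolding bidual_ball_iff
    by (simp add: canonical_embedding_def add_in_dual_space mult_in_dual_space blinfun.add_left)
qed

text \<open>
  The extreme point maximizes the real part of evaluation at \<open>f\<close>; comparing it with the images of
  suitably rotated points of the unit ball of \<open>X\<close> bounds \<open>f\<close>.
\<close>

lemma functional_norm_attained_at_extreme_point:
  assumes f: "f \<in> dual_space scale"
  obtains e where "e extreme_point_of bidual_ball scale" "norm f \<le> norm (e f)"
proof -
  define L where "L = {l. \<exists>d h. l = (\<lambda>\<Phi> :: ('a \<Rightarrow>\<^sub>L 'k) \<Rightarrow> 'k. real_part (d * \<Phi> h))}"
  interpret re: bounded_linear "real_part :: 'k \<Rightarrow> real" by (rule bounded_linear_real_part)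
  obtain e where e: "e extreme_point_of bidual_ball scale"
      "\<And>\<Phi>. \<Phi> \<in> bidual_ball scale \<Longrightarrow> real_part (1 * \<Phi> f) \<le> real_part (1 * e f)"
  proof (rule extreme_point_maximizing_functional[of "bidual_ball scale" L "\<lambda>\<Phi>. real_part (1 * \<Phi> f)"])
    show "bidual_ball scale \<noteq> {}"
      using canonical_embedding_in_bidual_ball[of 0] by auto
    show "linear l" if "l \<in> L" for l
      using that unfolding L_def
      by (auto intro!: linearI simp: scaleR_fun_def distrib_left re.add re.scaleR)
    show "continuous_on (bidual_ball scale) l" if lL: "l \<in> L" for l
    proof -
      obtain d h where l: "l = (\<lambda>\<Phi>. real_part (d * \<Phi> h))" using lL unfolding L_def by blast
      have "continuous_on UNIV l"
        unfolding l by (intro re.continuous_on continuous_intros continuous_on_product_coordinates)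
      then show ?thesis by (rule continuous_on_subset) simp
    qed
    show "\<exists>l\<in>L. l \<Phi> \<noteq> l \<Psi>" if "\<Phi> \<noteq> \<Psi>" for \<Phi> \<Psi>
    proof -
      have "\<exists>h. \<Phi> h \<noteq> \<Psi> h" using that by (simp add: fun_eq_iff)
      then obtain h where h: "\<Phi> h \<noteq> \<Psi> h" ..
      let ?d = "1 / (\<Phi> h - \<Psi> h)"
      have "?d * (\<Phi> h - \<Psi> h) = of_real 1"
        using h by simp
      then have "real_part (?d * \<Phi> h) - real_part (?d * \<Psi> h) = 1"
        by (simp only: right_diff_distrib real_part_of_real flip: re.diff)
      then have "real_part (?d * \<Phi> h) \<noteq> real_part (?d * \<Psi> h)"
        by simp
      moreover have "(\<lambda>\<Phi>. real_part (?d * \<Phi> h)) \<in> L"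
        unfolding L_def by (intro CollectI exI[of _ "?d"] exI[of _ h] refl)
      ultimately show ?thesis by (rule bexI)
    qed
    show "(\<lambda>\<Phi>. real_part (1 * \<Phi> f)) \<in> L"
      unfolding L_def by (intro CollectI exI[of _ 1] exI[of _ f] refl)
  qed (rule compact_bidual_ball | rule closed_bidual_ball | rule convex_bidual_ball | blast)+
  have "norm f \<le> norm (e f)"
  proof (rule norm_blinfun_bound)
    fix x
    show "norm (f x) \<le> norm (e f) * norm x"
    proof (cases "f x = 0")
      case False
      then have x: "x \<noteq> 0" by auto
      define z where "z = scale (of_real (norm (f x) / norm x) / f x) x"
      have "norm z = 1"
        using False x by (simp add: z_def norm_scale norm_divide norm_mult)
      moreover have "f z = of_real (norm (f x) / norm x)"
        using False f by (simp add: z_def dual_space_iff)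
      ultimately have "norm (f x) / norm x \<le> real_part (e f)"
        using e(2)[OF canonical_embedding_in_bidual_ball[of z]] f
        by (simp only: canonical_embedding_def if_True mult_1 real_part_of_real order_refl)
      also have "\<dots> \<le> norm (e f)" by (rule real_part_le_norm)
      finally show ?thesis using x by (simp add: field_simps)
    qed simp
  qed simp
  with e(1) show ?thesis by (rule that)
qed

text \<open>
  This is all that the rest of the proof uses of the condition on extreme points. An invariant
  functional takes the same value at \<open>g a\<close> and at \<open>a\<close>, so the orbit under the group reduces to
  points of the family.
\<close>

lemma quasi_alpha_family_norming:
  assumes fam: "quasi_alpha_family scale G \<Lambda> x x' \<rho>"
    and f: "f \<in> dual_space scale" "invariant G f"
  obtains A where "A \<subseteq> x ` \<Lambda>" "(SUP a\<in>A. \<rho> a) < 1" "\<forall>d>0. \<exists>a\<in>A. norm f - d < norm (f a)"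
proof -
  obtain e where e: "e extreme_point_of bidual_ball scale" "norm f \<le> norm (e f)"
    by (rule functional_norm_attained_at_extreme_point[OF f(1)])
  from fam have "\<forall>e. e extreme_point_of bidual_ball scale \<longrightarrow>
      (\<exists>A t. A \<subseteq> x ` \<Lambda> \<and> norm t = 1 \<and>
        (\<lambda>f. t * e f) \<in> weak_star_topology scale closure_of
          (canonical_embedding scale ` {blinfun_apply g a | g a. g \<in> G \<and> a \<in> A}) \<and>
        (SUP a\<in>A. \<rho> a) < 1)"
    unfolding quasi_alpha_family_def by (elim conjE)
  with e(1) obtain A t where A: "A \<subseteq> x ` \<Lambda>" "(SUP a\<in>A. \<rho> a) < 1" and t: "norm t = 1"
    and cl: "(\<lambda>f. t * e f) \<in> weak_star_topology scale closure_of
             (canonical_embedding scale ` {blinfun_apply g a | g a. g \<in> G \<and> a \<in> A})"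
    by blast
  have "\<forall>d>0. \<exists>a\<in>A. norm f - d < norm (f a)"
  proof (intro allI impI)
    fix d :: real
    assume d: "d > 0"
    let ?U = "{\<Phi>. norm f - d < norm (\<Phi> f)}"
    have "open ?U"
      by (intro open_Collect_less continuous_intros continuous_on_product_coordinates)
    then have U: "openin (weak_star_topology scale) (?U \<inter> bidual_space scale)"
      unfolding weak_star_topology_def euclidean_product_topology
      by (intro openin_subtopology_Int) (simp only: open_openin)
    have "(\<lambda>f. t * e f) \<in> ?U \<inter> bidual_space scale"
      using cl e(2) t d
      by (auto simp: in_closure_of weak_star_topology_def norm_mult)
    with U have "(\<lambda>f. t * e f) \<in> ?U \<inter> bidual_space scale \<and>
        openin (weak_star_topology scale) (?U \<inter> bidual_space scale)"
      by (intro conjI)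
    with conjunct2[OF cl[unfolded in_closure_of]]
    have "\<exists>y. y \<in> canonical_embedding scale ` {blinfun_apply g a | g a. g \<in> G \<and> a \<in> A} \<and>
        y \<in> ?U \<inter> bidual_space scale"
      by (elim allE[of _ "?U \<inter> bidual_space scale"] impE)
    then obtain y where "y \<in> canonical_embedding scale ` {blinfun_apply g a | g a. g \<in> G \<and> a \<in> A}"
        and y: "y \<in> ?U"
      by (elim exE conjE IntE)
    then obtain g a where "g \<in> G" "a \<in> A" and ga: "y = canonical_embedding scale (blinfun_apply g a)"
      by (elim imageE CollectE exE conjE) simp
    have "norm f - d < norm (f (blinfun_apply g a))"
      using y f(1) unfolding ga canonical_embedding_def by simp
    also have "f (blinfun_apply g a) = f a"
      using f(2) \<open>g \<in> G\<close> by (simp add: invariant_def)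
    finally show "\<exists>a\<in>A. norm f - d < norm (f a)"
      using \<open>a \<in> A\<close> by (rule bexI)
  qed
  with A show ?thesis by (rule that)
qed

end

section \<open>Estimates for operator norms\<close>

lemma norm_blinfun_le_of_norm_le_one:
  "norm x \<le> 1 \<Longrightarrow> norm (blinfun_apply T x) \<le> norm T"
  using norm_blinfun[of T x] mult_left_mono[of "norm x" 1 "norm T"] by simp

lemma norm_contraction_le:
  fixes T :: "'a::real_normed_vector \<Rightarrow>\<^sub>L 'b::real_normed_vector" and y :: "'b \<Rightarrow>\<^sub>L 'c::real_normed_vector"
  assumes "norm y \<le> 1"
  shows "norm (y v) \<le> norm v" "norm (y o\<^sub>L T) \<le> norm T"
proof -
  show "norm (y v) \<le> norm v"
    using norm_blinfun[of y v] mult_right_mono[OF assms, of "norm v"] by simp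
  show "norm (y o\<^sub>L T) \<le> norm T"
    using norm_blinfun_compose[of y T] mult_right_mono[OF assms, of "norm T"] by simp
qed

lemma blinfun_norm_almost_attained:
  assumes "d > 0"
  obtains x where "norm x \<le> 1" "norm T - d < norm (blinfun_apply T x)"
proof (rule ccontr)
  assume "\<not> thesis"
  with that have le: "norm (blinfun_apply T x) \<le> norm T - d" if "norm x \<le> 1" for x
    using that by (meson not_le_imp_less)
  have nonneg: "0 \<le> norm T - d"
    using le[of 0] by simp
  have "norm T \<le> norm T - d"
  proof (rule norm_blinfun_bound[OF nonneg])
    fix x
    show "norm (blinfun_apply T x) \<le> (norm T - d) * norm x"
    proof (cases "x = 0")
      case False
      then have "norm (blinfun_apply T ((1 / norm x) *\<^sub>R x)) \<le> norm T - d"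
        by (intro le) simp
      with False show ?thesis
        by (simp add: blinfun.scaleR_right field_simps)
    qed simp
  qed
  with assms show False by simp
qed

lemma (in scalar_banach) bounded_linear_scale: "bounded_linear (scale c)"
proof (rule bounded_linear_intro[where K = "norm c"])
  show "scale c (r *\<^sub>R x) = r *\<^sub>R scale c x" for r x
    by (simp add: mult.commute flip: scale_of_real)
qed (simp_all add: scale_right_distrib norm_scale mult.commute)

lemma (in scalar_banach) norm_blinfun_le_dual_bound:
  fixes T :: "'c::real_normed_vector \<Rightarrow>\<^sub>L 'a"
  assumes "\<And>y. y \<in> dual_space scale \<Longrightarrow> norm y \<le> 1 \<Longrightarrow> norm (y o\<^sub>L T) \<le> c"
  shows "norm T \<le> c"
proof (rule norm_blinfun_bound)
  have "norm ((0 :: 'a \<Rightarrow>\<^sub>L 'k) o\<^sub>L T) \<le> c"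
    by (rule assms) (simp_all add: zero_in_dual_space)
  then show "0 \<le> c" by (rule order_trans[OF norm_ge_zero])
  fix x
  obtain y where y: "y \<in> dual_space scale" "norm y \<le> 1" "y (T x) = of_real (norm (T x))"
    using hahn_banach_norming[of "T x"] by blast
  have "norm (T x) = norm ((y o\<^sub>L T) x)"
    using y by simp
  also have "\<dots> \<le> norm (y o\<^sub>L T) * norm x"
    by (rule norm_blinfun)
  also have "\<dots> \<le> c * norm x"
    using assms[OF y(1,2)] by (rule mult_right_mono) simp
  finally show "norm (T x) \<le> c * norm x" .
qed

text \<open>With functionals viewed as plain functions, weak-star convergence is pointwise convergence.\<close>

lemma (in scalar_banach) compact_dual_ball:
  "compact {\<phi> :: 'a \<Rightarrow> 'k. (\<forall>x z. \<phi> (x + z) = \<phi> x + \<phi> z) \<and> (\<forall>c x. \<phi> (scale c x) = c * \<phi> x) \<and>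
     (\<forall>x. norm (\<phi> x) \<le> norm x)}" (is "compact ?K")
proof -
  let ?B = "{\<phi> :: 'a \<Rightarrow> 'k. \<forall>x. norm (\<phi> x) \<le> norm x}"
  have "closed ?K"
    by (intro closed_Collect_conj closed_Collect_all closed_Collect_eq
      closed_Collect_le continuous_intros continuous_on_product_coordinates)
  then have "compact (?B \<inter> ?K)"
    by (rule compact_Int_closed[OF compact_bounded_functions])
  moreover have "?B \<inter> ?K = ?K"
    by (rule Int_absorb1) (intro Collect_mono impI, elim conjE)
  ultimately show ?thesis by (simp only:)
qed

text \<open>
  The arithmetic of the first perturbation. Below, \<open>s\<close> is the norm of \<open>T\<close>, \<open>a\<close> that of \<open>T x\<close> and
  \<open>b\<close> that of \<open>y (T x)\<close>. The last premise holds if \<open>y\<close> almost attains the norm of the adjoint of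
  the perturbed operator \<open>R\<close>, and the conclusion bounds \<open>y (R x)\<close> from below. For fixed \<open>\<eta>\<close> the
  premises force both \<open>a\<close> and \<open>b\<close> to \<open>s\<close> as \<open>\<theta>\<close> tends to \<open>0\<close>.
\<close>

lemma perturbation_estimate:
  fixes s \<eta> \<epsilon> :: real
  assumes "s > 0" "\<eta> > 0" "\<epsilon> > 0"
  obtains \<theta> where "\<theta> > 0"
    "\<And>a b. s - \<theta> < a \<Longrightarrow> a \<le> s \<Longrightarrow> 0 \<le> b \<Longrightarrow> b \<le> a \<Longrightarrow> a * (1 + \<eta> * a) - \<theta> < s + \<eta> * s * b \<Longrightarrow>
       s + \<eta> * s\<^sup>2 - \<epsilon> < (1 + \<eta> * a) * b"
proof -
  \<comment> \<open>the premises give \<open>s - b < \<kappa> * \<theta>\<close>\<close>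
  define \<kappa> where "\<kappa> = 2 + 2 / (\<eta> * s)"
  define \<theta> where "\<theta> = min s (\<epsilon> / (\<kappa> * (1 + \<eta> * s) + \<eta> * s))"
  have \<kappa>: "\<kappa> > 0" and den: "\<kappa> * (1 + \<eta> * s) + \<eta> * s > 0"
    using assms by (simp_all add: \<kappa>_def add_pos_pos)
  have \<theta>: "\<theta> > 0" "\<theta> \<le> s"
    using assms den by (simp_all add: \<theta>_def)
  have "\<theta> \<le> \<epsilon> / (\<kappa> * (1 + \<eta> * s) + \<eta> * s)" by (simp add: \<theta>_def)
  then have \<theta>_le: "\<theta> * (\<kappa> * (1 + \<eta> * s) + \<eta> * s) \<le> \<epsilon>"
    using den by (simp add: pos_le_divide_eq)
  show ?thesis
  proof (rule that[OF \<theta>(1)])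
    fix a b
    assume a: "s - \<theta> < a" "a \<le> s" and b: "0 \<le> b" "b \<le> a"
      and ab: "a * (1 + \<eta> * a) - \<theta> < s + \<eta> * s * b"
    have "(s - \<theta>)\<^sup>2 \<le> a\<^sup>2"
      using a \<theta> by (intro power_mono) auto
    then have "s\<^sup>2 - 2 * s * \<theta> \<le> a\<^sup>2"
      using zero_le_power2[of \<theta>] unfolding power2_diff by linarith
    then have "s\<^sup>2 - 2 * \<theta> * s \<le> a\<^sup>2"
      by (simp only: mult_ac)
    then have "\<eta> * (s\<^sup>2 - 2 * \<theta> * s) \<le> \<eta> * a\<^sup>2"
      using assms by (intro mult_left_mono) auto
    moreover have "\<eta> * a\<^sup>2 - 2 * \<theta> < \<eta> * s * b"
      using ab a by (simp add: power2_eq_square algebra_simps)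
    ultimately have "\<eta> * (s\<^sup>2 - 2 * \<theta> * s) - 2 * \<theta> < \<eta> * s * b" by linarith
    moreover have "\<eta> * s * (\<kappa> * \<theta>) = \<eta> * (2 * \<theta> * s) + 2 * \<theta>"
      using assms by (simp add: \<kappa>_def field_simps)
    ultimately have "\<eta> * s * (s - b) < \<eta> * s * (\<kappa> * \<theta>)"
      by (simp add: algebra_simps power2_eq_square)
    then have sb: "s - b < \<kappa> * \<theta>"
      using assms by (simp add: mult_less_cancel_left_pos)
    have "s + \<eta> * s\<^sup>2 - (1 + \<eta> * a) * b = (1 + \<eta> * s) * (s - b) + \<eta> * b * (s - a)"
      by (simp add: algebra_simps power2_eq_square)
    also have "(1 + \<eta> * s) * (s - b) < (1 + \<eta> * s) * (\<kappa> * \<theta>)"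
      using sb assms by (intro mult_strict_left_mono) (auto intro: add_pos_pos)
    also have "\<eta> * b * (s - a) \<le> \<eta> * s * \<theta>"
      using a b assms by (intro mult_mono) auto
    also have "(1 + \<eta> * s) * (\<kappa> * \<theta>) + \<eta> * s * \<theta> = \<theta> * (\<kappa> * (1 + \<eta> * s) + \<eta> * s)"
      by (simp add: algebra_simps)
    finally show "s + \<eta> * s\<^sup>2 - \<epsilon> < (1 + \<eta> * a) * b"
      using \<theta>_le by linarith
  qed
qed

section \<open>Operators whose adjoint attains its norm\<close>

definition rank_one :: "('k::real_or_complex_field \<Rightarrow> 'b::banach \<Rightarrow> 'b) \<Rightarrow> ('a::banach \<Rightarrow>\<^sub>L 'k) \<Rightarrow> 'b \<Rightarrow> 'a \<Rightarrow>\<^sub>L 'b"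
  where "rank_one sY f v = Blinfun (\<lambda>x. sY (f x) v)"

text \<open>
  The sets \<open>U\<^sub>\<epsilon>\<close> to which Baire's theorem is applied. The slack \<open>c < \<epsilon>\<close> makes them open: a small
  change of the operator increases \<open>c\<close> a little and decreases \<open>\<delta>\<close>.
\<close>

definition almost_norming_operators ::
  "('k::real_or_complex_field \<Rightarrow> 'a::banach \<Rightarrow> 'a) \<Rightarrow> ('k \<Rightarrow> 'b::banach \<Rightarrow> 'b)
    \<Rightarrow> ('a \<Rightarrow>\<^sub>L 'a) set \<Rightarrow> real \<Rightarrow> ('a \<Rightarrow>\<^sub>L 'b) set" where
  "almost_norming_operators sX sY G \<epsilon> = {T \<in> invariant_operators sX sY G.
     \<exists>x\<in>cball 0 1. \<exists>c<\<epsilon>. \<exists>\<delta>>0. \<forall>y\<in>dual_space sY \<inter> cball 0 1.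
       norm T - \<delta> < norm (y o\<^sub>L T) \<longrightarrow> norm T - c < norm (y (T x))}"

locale banach_pair = X: scalar_banach sX + Y: scalar_banach sY
  for sX :: "'k::real_or_complex_field \<Rightarrow> 'a::banach \<Rightarrow> 'a"
    and sY :: "'k \<Rightarrow> 'b::banach \<Rightarrow> 'b" +
  fixes G :: "('a \<Rightarrow>\<^sub>L 'a) set"
begin

lemma invariant_operators_iff:
  "T \<in> invariant_operators sX sY G \<longleftrightarrow>
     (\<forall>c x. T (sX c x) = sY c (T x)) \<and> (\<forall>g\<in>G. \<forall>x. T (blinfun_apply g x) = T x)"
  by (simp add: invariant_operators_def operators_iff invariant_def
      X.vector_space_axioms Y.vector_space_axioms)

lemma closed_invariant_operators: "closed (invariant_operators sX sY G)"
proof -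
  have "invariant_operators sX sY G = {T :: 'a \<Rightarrow>\<^sub>L 'b. (\<forall>c x. T (sX c x) = sY c (T x)) \<and>
      (\<forall>g. g \<in> G \<longrightarrow> (\<forall>x. T (blinfun_apply g x) = T x))}"
    by (rule set_eqI) (simp only: mem_Collect_eq invariant_operators_iff Ball_def)
  also have "closed \<dots>"
    by (intro closed_Collect_conj closed_Collect_all closed_Collect_imp closed_Collect_eq
        open_Collect_const bounded_linear.continuous_on[OF Y.bounded_linear_scale] continuous_intros)
  finally show ?thesis .
qed

lemma rank_one_apply: "rank_one sY f v x = sY (f x) v"
  and norm_rank_one_le: "norm (rank_one sY f v) \<le> norm f * norm v"
proof -
  have bound: "norm (sY (f x) v) \<le> norm f * norm v * norm x" for x
    using mult_right_mono[OF norm_blinfun[of f x], of "norm v"]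
    by (simp add: Y.norm_scale mult_ac)
  have "bounded_linear (\<lambda>x. sY (f x) v)"
  proof (rule bounded_linear_intro[where K = "norm f * norm v"])
    show "sY (f (r *\<^sub>R x)) v = r *\<^sub>R sY (f x) v" for r x
      by (simp add: blinfun.scaleR_right scaleR_conv_of_real flip: Y.scale_of_real)
  qed (use bound in \<open>simp_all add: blinfun.add_right Y.scale_left_distrib mult_ac\<close>)
  then show ap: "rank_one sY f v x = sY (f x) v" for x
    unfolding rank_one_def by (subst bounded_linear_Blinfun_apply) simp_all
  show "norm (rank_one sY f v) \<le> norm f * norm v"
    by (rule norm_blinfun_bound) (simp_all add: ap bound)
qed

lemma perturbation_in_invariant_operators:
  assumes T: "T \<in> invariant_operators sX sY G" and f: "f \<in> dual_space sX" "invariant G f"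
  shows "T + \<eta> *\<^sub>R rank_one sY f v \<in> invariant_operators sX sY G"
  using assms
  by (simp add: invariant_operators_iff X.dual_space_iff invariant_def blinfun.add_left
      blinfun.scaleR_left rank_one_apply Y.scale_right_distrib
      linear_scale[OF bounded_linear.linear, OF Y.bounded_linear_scale])

lemma compose_in_dual_space:
  assumes "T \<in> invariant_operators sX sY G" "y \<in> dual_space sY"
  shows "y o\<^sub>L T \<in> dual_space sX" "invariant G (y o\<^sub>L T)"
  using assms by (simp_all add: invariant_operators_iff X.dual_space_iff Y.dual_space_iff invariant_def)

lemma almost_norming_operators_open:
  assumes T: "T \<in> almost_norming_operators sX sY G \<epsilon>"
  obtains r where "r > 0"
    "\<forall>R\<in>invariant_operators sX sY G. dist R T < r \<longrightarrow> R \<in> almost_norming_operators sX sY G \<epsilon>"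
proof -
  obtain x c \<delta> where x: "x \<in> cball 0 1" and c: "c < \<epsilon>" and \<delta>: "\<delta> > 0"
    and imp: "\<And>y. y \<in> dual_space sY \<inter> cball 0 1 \<Longrightarrow> norm T - \<delta> < norm (y o\<^sub>L T) \<Longrightarrow>
        norm T - c < norm (y (T x))"
    using T unfolding almost_norming_operators_def by blast
  define r where "r = min (\<delta> / 3) ((\<epsilon> - c) / 3)"
  have r: "r > 0" "3 * r \<le> \<delta>" "3 * r \<le> \<epsilon> - c"
    using c \<delta> by (auto simp: r_def min_def)
  show ?thesis
  proof (rule that[OF r(1)], intro ballI impI)
    fix R
    assume R: "R \<in> invariant_operators sX sY G" and "dist R T < r"
    then have d: "norm (R - T) < r" by (simp add: dist_norm)
    have RT: "norm R < norm T + r" "norm T < norm R + r"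
      using d norm_triangle_ineq2[of R T] norm_triangle_ineq2[of T R]
      by (simp_all add: norm_minus_commute)
    have "norm R - (c + 2 * r) < norm (y (R x))"
      if y: "y \<in> dual_space sY \<inter> cball 0 1" and ynorm: "norm R - r < norm (y o\<^sub>L R)" for y
    proof -
      have y1: "norm y \<le> 1" using y by simp
      have "y o\<^sub>L R = (y o\<^sub>L T) + (y o\<^sub>L (R - T))"
        by (rule blinfun_eqI) (simp add: blinfun.add_left blinfun.diff_left blinfun.diff_right)
      then have "norm (y o\<^sub>L R) \<le> norm (y o\<^sub>L T) + norm (y o\<^sub>L (R - T))"
        by (simp only: norm_triangle_ineq)
      then have "norm (y o\<^sub>L R) < norm (y o\<^sub>L T) + r"
        using norm_contraction_le(2)[OF y1, of "R - T"] d
        by linarith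
      with ynorm RT r have "norm T - \<delta> < norm (y o\<^sub>L T)" by linarith
      with imp y have le: "norm T - c < norm (y (T x))" by blast
      have "norm (y ((R - T) x)) < r"
        using norm_contraction_le(1)[OF y1, of "(R - T) x"]
          norm_blinfun_le_of_norm_le_one[of x "R - T"] x d by simp
      moreover have "y (T x) = y (R x) - y ((R - T) x)"
        by (simp add: blinfun.diff_left blinfun.diff_right)
      ultimately have "norm (y (T x)) < norm (y (R x)) + r"
        using norm_triangle_ineq4[of "y (R x)" "y ((R - T) x)"] by simp
      with le RT show ?thesis by linarith
    qed
    moreover have "c + 2 * r < \<epsilon>" using r by linarith
    ultimately show "R \<in> almost_norming_operators sX sY G \<epsilon>"
      using R r(1) x unfolding almost_norming_operators_def by blast
  qed
qed

text \<open>
  For \<open>R = T + \<eta> (y\<^sub>0 \<circ> T) \<otimes> T x\<close>, evaluation at \<open>x\<close> gives \<open>\<parallel>R\<parallel> \<ge> a (1 + \<eta> a)\<close> with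
  \<open>a = \<parallel>T x\<parallel>\<close>, while \<open>\<parallel>y \<circ> R\<parallel> \<le> s + \<eta> s \<bar>y (T x)\<bar>\<close> with \<open>s = \<parallel>T\<parallel>\<close>. As \<open>a\<close> is close to \<open>s\<close>,
  \<open>y\<close> can almost attain the norm of the adjoint only if \<open>\<bar>y (T x)\<bar>\<close> is close to \<open>s\<close>.
\<close>

lemma almost_norming_operators_dense:
  assumes T: "T \<in> invariant_operators sX sY G" and \<epsilon>: "\<epsilon> > 0" and r: "r > 0"
  obtains R where "R \<in> almost_norming_operators sX sY G \<epsilon>" "dist R T < r"
proof (cases "T = 0")
  case True
  have "T \<in> almost_norming_operators sX sY G \<epsilon>"
    unfolding almost_norming_operators_def
    using T True \<epsilon> by (intro CollectI conjI bexI[of _ 0] exI[of _ "\<epsilon> / 2"] exI[of _ 1]) auto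
  then show ?thesis using r by (intro that[of T]) simp_all
next
  case False
  define s where "s = norm T"
  have s: "s > 0" using False by (simp add: s_def)
  define \<eta> where "\<eta> = r / (2 * s\<^sup>2)"
  have \<eta>: "\<eta> > 0" "\<eta> * s\<^sup>2 < r"
    using s r by (simp_all add: \<eta>_def)
  obtain \<theta> where \<theta>: "\<theta> > 0"
    "\<And>a b. s - \<theta> < a \<Longrightarrow> a \<le> s \<Longrightarrow> 0 \<le> b \<Longrightarrow> b \<le> a \<Longrightarrow> a * (1 + \<eta> * a) - \<theta> < s + \<eta> * s * b \<Longrightarrow>
       s + \<eta> * s\<^sup>2 - \<epsilon> / 2 < (1 + \<eta> * a) * b"
    using perturbation_estimate[OF s \<eta>(1) half_gt_zero[OF \<epsilon>]] by blast
  obtain x where x: "norm x \<le> 1" "s - \<theta> < norm (T x)"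
    using blinfun_norm_almost_attained[OF \<theta>(1), of T] by (auto simp: s_def)
  define a where "a = norm (T x)"
  have a: "s - \<theta> < a" "a \<le> s" "0 \<le> a"
    using x norm_blinfun_le_of_norm_le_one[of x T] by (simp_all add: a_def s_def)
  obtain y0 where y0: "y0 \<in> dual_space sY" "norm y0 \<le> 1" "y0 (T x) = of_real a"
    using Y.hahn_banach_norming[of "T x"] unfolding a_def by blast
  define R where "R = T + \<eta> *\<^sub>R rank_one sY (y0 o\<^sub>L T) (T x)"
  have R: "R \<in> invariant_operators sX sY G"
    unfolding R_def by (intro perturbation_in_invariant_operators T compose_in_dual_space[OF T y0(1)])
  have R_apply: "R z = T z + \<eta> *\<^sub>R sY (y0 (T z)) (T x)" for z
    by (simp add: R_def blinfun.add_left blinfun.scaleR_left rank_one_apply)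
  have "norm (rank_one sY (y0 o\<^sub>L T) (T x)) \<le> norm (y0 o\<^sub>L T) * norm (T x)"
    by (rule norm_rank_one_le)
  also have "\<dots> \<le> s * s"
    using norm_contraction_le(2)[OF y0(2), of T] a
    by (intro mult_mono) (simp_all add: s_def a_def)
  finally have diff: "norm (\<eta> *\<^sub>R rank_one sY (y0 o\<^sub>L T) (T x)) \<le> \<eta> * s\<^sup>2"
    using \<eta> by (simp add: power2_eq_square)
  have normR: "norm R \<le> s + \<eta> * s\<^sup>2"
    unfolding R_def using norm_triangle_ineq[of T] diff unfolding s_def[symmetric]
    by (rule order_trans[OF _ add_left_mono])
  have Rx: "R x = (1 + \<eta> * a) *\<^sub>R T x"
    by (simp add: R_apply y0(3) Y.scale_of_real scaleR_add_left)
  have pos: "0 \<le> 1 + \<eta> * a" using a \<eta> by simp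
  have lower: "a * (1 + \<eta> * a) \<le> norm R"
    using norm_blinfun_le_of_norm_le_one[OF x(1), of R] pos by (simp add: Rx a_def mult.commute)
  have "norm R - \<epsilon> / 2 < norm (y (R x))"
    if y: "y \<in> dual_space sY \<inter> cball 0 1" and ynorm: "norm R - \<theta> < norm (y o\<^sub>L R)" for y
  proof -
    have y1: "norm y \<le> 1" using y by simp
    define b where "b = norm (y (T x))"
    have b: "0 \<le> b" "b \<le> a"
      using norm_contraction_le(1)[OF y1] by (simp_all add: b_def a_def)
    have "norm (y o\<^sub>L R) \<le> s + \<eta> * s * b"
    proof (rule norm_blinfun_bound)
      show "0 \<le> s + \<eta> * s * b" using s \<eta> b by simp
      fix z
      have "norm (y0 (T z)) \<le> s * norm z"
        using norm_contraction_le(1)[OF y0(2), of "T z"] norm_blinfun[of T z]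
        unfolding s_def by (rule order_trans)
      then have "\<eta> * norm (y0 (T z)) * b \<le> \<eta> * (s * norm z) * b"
        using \<eta> b by (intro mult_right_mono mult_left_mono) auto
      moreover have "norm (y (T z)) \<le> s * norm z"
        using norm_contraction_le(1)[OF y1, of "T z"] norm_blinfun[of T z]
        unfolding s_def by (rule order_trans)
      moreover have "(y o\<^sub>L R) z = y (T z) + \<eta> *\<^sub>R (y0 (T z) * y (T x))"
        using y by (simp add: R_apply blinfun.add_right blinfun.scaleR_right Y.dual_space_iff)
      then have "norm ((y o\<^sub>L R) z) \<le> norm (y (T z)) + \<eta> * norm (y0 (T z)) * b"
        using norm_triangle_ineq[of "y (T z)" "\<eta> *\<^sub>R (y0 (T z) * y (T x))"] \<eta>
        by (simp add: norm_mult b_def)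
      ultimately show "norm ((y o\<^sub>L R) z) \<le> (s + \<eta> * s * b) * norm z"
        by (simp add: algebra_simps)
    qed
    with ynorm lower have "a * (1 + \<eta> * a) - \<theta> < s + \<eta> * s * b" by linarith
    with \<theta>(2)[OF a(1,2) b] have "s + \<eta> * s\<^sup>2 - \<epsilon> / 2 < (1 + \<eta> * a) * b" by blast
    also have "(1 + \<eta> * a) * b = norm (y (R x))"
      using pos by (simp add: Rx b_def blinfun.scaleR_right)
    finally show ?thesis using normR by linarith
  qed
  then have "R \<in> almost_norming_operators sX sY G \<epsilon>"
    unfolding almost_norming_operators_def using R x(1) \<theta>(1) \<epsilon>
    by (intro CollectI conjI bexI[of _ x] exI[of _ "\<epsilon> / 2"] exI[of _ \<theta>]) auto
  moreover have "dist R T < r"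
    using diff \<eta>(2) by (simp add: dist_norm R_def)
  ultimately show ?thesis by (rule that)
qed

lemma almost_norming_at_all_scales_dense:
  assumes T: "T \<in> invariant_operators sX sY G" and r: "r > 0"
  obtains R where "R \<in> invariant_operators sX sY G"
    "\<forall>n. R \<in> almost_norming_operators sX sY G (inverse (real (Suc n)))" "dist R T < r"
proof -
  let ?L = "invariant_operators sX sY G"
  let ?U = "\<lambda>n. almost_norming_operators sX sY G (inverse (real (Suc n)))"
  have sub: "?U n \<subseteq> ?L" for n
    by (auto simp: almost_norming_operators_def)
  have "completely_metrizable_space (top_of_set ?L)"
    using closed_invariant_operators completely_metrizable_space_closedin[OF completely_metrizable_space_euclidean]
    by simp
  then have "top_of_set ?L closure_of (\<Inter>(range ?U)) = topspace (top_of_set ?L)"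
  proof (intro Baire_category disjI1)
    fix V assume "V \<in> range ?U"
    then obtain n where V: "V = ?U n" by blast
    have "openin (top_of_set ?L) (?U n)"
      unfolding openin_euclidean_subtopology_iff
    proof (intro conjI sub ballI)
      fix S assume S: "S \<in> ?U n"
      obtain \<delta> where "\<delta> > 0" "\<forall>R\<in>?L. dist R S < \<delta> \<longrightarrow> R \<in> ?U n"
        by (rule almost_norming_operators_open[OF S])
      then show "\<exists>e>0. \<forall>x'\<in>?L. dist x' S < e \<longrightarrow> x' \<in> ?U n" by blast
    qed
    moreover have "?L \<subseteq> closure (?U n)"
    proof
      fix S assume S: "S \<in> ?L"
      show "S \<in> closure (?U n)"
        unfolding closure_approachable
      proof (intro allI impI)
        fix e :: real assume "e > 0"
        then show "\<exists>R\<in>?U n. dist R S < e"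
          using almost_norming_operators_dense[OF S, of "inverse (real (Suc n))" e] by auto
      qed
    qed
    ultimately show "openin (top_of_set ?L) V \<and> top_of_set ?L closure_of V = topspace (top_of_set ?L)"
      using sub[of n] by (auto simp: V closure_of_subtopology Int_absorb1)
  qed auto
  then have "?L = ?L \<inter> closure (?L \<inter> (\<Inter>(range ?U)))"
    by (simp add: closure_of_subtopology)
  also have "?L \<inter> (\<Inter>(range ?U)) = \<Inter>(range ?U)"
    using sub by blast
  finally have "?L \<subseteq> closure (\<Inter>(range ?U))"
    by blast
  with T r obtain R where "R \<in> \<Inter>(range ?U)" "dist R T < r"
    unfolding closure_approachable by (meson subsetD closure_approachable)
  then show ?thesis
    using sub by (intro that[of R]) blast+
qed

text \<open>
  The \<open>n\<close>-th condition on \<open>y\<close> is closed for pointwise convergence and holds for all \<open>y\<close> that attain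
  the norm of the adjoint up to \<open>\<delta> n\<close>. Such \<open>y\<close> exist, so finitely many conditions are always
  compatible, and compactness of the dual ball solves them all at once.
\<close>

lemma adjoint_norm_attaining:
  assumes U: "\<forall>n. R \<in> almost_norming_operators sX sY G (inverse (real (Suc n)))"
  obtains y where "y \<in> dual_space sY" "norm y \<le> 1" "norm (y o\<^sub>L R) = norm R"
proof -
  have "\<forall>n. \<exists>x \<delta>. norm x \<le> 1 \<and> \<delta> > 0 \<and> (\<forall>y\<in>dual_space sY \<inter> cball 0 1.
      norm R - \<delta> < norm (y o\<^sub>L R) \<longrightarrow> norm R - inverse (real (Suc n)) \<le> norm (y (R x)))"
  proof
    fix n
    obtain x c \<delta> where "x \<in> cball 0 1" and c: "c < inverse (real (Suc n))" and "\<delta> > 0"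
      and imp: "\<forall>y\<in>dual_space sY \<inter> cball 0 1. norm R - \<delta> < norm (y o\<^sub>L R) \<longrightarrow> norm R - c < norm (y (R x))"
      using U[rule_format, of n] unfolding almost_norming_operators_def by blast
    moreover have "norm R - inverse (real (Suc n)) \<le> t" if "norm R - c < t" for t
      using c that by linarith
    ultimately show "\<exists>x \<delta>. norm x \<le> 1 \<and> \<delta> > 0 \<and> (\<forall>y\<in>dual_space sY \<inter> cball 0 1.
      norm R - \<delta> < norm (y o\<^sub>L R) \<longrightarrow> norm R - inverse (real (Suc n)) \<le> norm (y (R x)))"
      by (intro exI[of _ x] exI[of _ \<delta>]) auto
  qed
  then obtain x \<delta> where *: "\<forall>n. norm (x n) \<le> 1 \<and> \<delta> n > 0 \<and> (\<forall>y\<in>dual_space sY \<inter> cball 0 1.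
      norm R - \<delta> n < norm (y o\<^sub>L R) \<longrightarrow> norm R - inverse (real (Suc n)) \<le> norm (y (R (x n))))"
    unfolding choice_iff by (elim exE)
  then have x: "\<And>n. norm (x n) \<le> 1" and \<delta>: "\<And>n. \<delta> n > 0"
    and imp: "\<And>n y. y \<in> dual_space sY \<Longrightarrow> norm y \<le> 1 \<Longrightarrow> norm R - \<delta> n < norm (y o\<^sub>L R) \<Longrightarrow>
        norm R - inverse (real (Suc n)) \<le> norm (y (R (x n)))"
    by simp_all
  let ?K = "{\<phi> :: 'b \<Rightarrow> 'k. (\<forall>x z. \<phi> (x + z) = \<phi> x + \<phi> z) \<and> (\<forall>c x. \<phi> (sY c x) = c * \<phi> x) \<and>
     (\<forall>x. norm (\<phi> x) \<le> norm x)}"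
  let ?C = "\<lambda>n. {\<phi> :: 'b \<Rightarrow> 'k. norm R - inverse (real (Suc n)) \<le> norm (\<phi> (R (x n)))}"
  have "?K \<inter> (\<Inter>n\<in>UNIV. ?C n) \<noteq> {}"
  proof (rule compact_imp_fip_image[OF Y.compact_dual_ball])
    show "closed (?C n)" for n
      by (intro closed_Collect_le continuous_intros continuous_on_product_coordinates)
    fix I :: "nat set"
    assume I: "finite I"
    define d where "d = Min (insert 1 (\<delta> ` I))"
    have d: "d > 0" "\<And>n. n \<in> I \<Longrightarrow> d \<le> \<delta> n"
      using I \<delta> by (auto simp: d_def)
    obtain y where y: "y \<in> dual_space sY" "norm y \<le> 1" "norm R - d < norm (y o\<^sub>L R)"
      using Y.norm_blinfun_le_dual_bound[of R "norm R - d"] d(1) by force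
    have "blinfun_apply y \<in> ?K"
      using y norm_contraction_le(1)[OF y(2)] by (simp add: Y.dual_space_iff blinfun.add_right)
    moreover have "blinfun_apply y \<in> ?C n" if "n \<in> I" for n
      using imp[OF y(1,2), of n] y(3) d(2)[OF that] by simp
    ultimately show "?K \<inter> (\<Inter>n\<in>I. ?C n) \<noteq> {}" by blast
  qed
  then obtain \<phi> where \<phi>_in: "\<phi> \<in> ?K \<inter> (\<Inter>n\<in>UNIV. ?C n)"
    unfolding ex_in_conv[symmetric] by (rule exE)
  note \<phi> = IntD1[OF \<phi>_in]
  have C: "norm R - inverse (real (Suc n)) \<le> norm (\<phi> (R (x n)))" for n
    using INT_D[OF IntD2[OF \<phi>_in] UNIV_I[of n]] unfolding mem_Collect_eq .
  have add: "\<phi> (v + w) = \<phi> v + \<phi> w" and scale: "\<phi> (sY c v) = c * \<phi> v" and le: "norm (\<phi> v) \<le> norm v" for v w c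
    using \<phi> unfolding mem_Collect_eq by simp_all
  have "bounded_linear \<phi>"
  proof (rule bounded_linear_intro[where K = 1])
    show "\<phi> (r *\<^sub>R v) = r *\<^sub>R \<phi> v" for r v
      using scale[of "of_real r" v] by (simp add: Y.scale_of_real scaleR_conv_of_real)
  qed (simp_all add: add le)
  then have ap: "blinfun_apply (Blinfun \<phi>) = \<phi>"
    by (rule bounded_linear_Blinfun_apply)
  show ?thesis
  proof (rule that[of "Blinfun \<phi>"])
    show "Blinfun \<phi> \<in> dual_space sY"
      by (simp add: Y.dual_space_iff ap scale)
    show le1: "norm (Blinfun \<phi>) \<le> 1"
      by (rule norm_blinfun_bound) (simp_all add: ap le)
    have "norm R \<le> norm (Blinfun \<phi> o\<^sub>L R) + inverse (real (Suc n))" for n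
      using C[of n] norm_blinfun_le_of_norm_le_one[OF x[of n], of "Blinfun \<phi> o\<^sub>L R"]
      by (simp add: ap)
    then have "norm R \<le> norm (Blinfun \<phi> o\<^sub>L R) + e" if "e > 0" for e
      using reals_Archimedean[OF that] by (meson add_left_mono less_imp_le order_trans)
    then have "norm R \<le> norm (Blinfun \<phi> o\<^sub>L R)"
      by (rule field_le_epsilon)
    with norm_contraction_le(2)[OF le1, of R]
    show "norm (Blinfun \<phi> o\<^sub>L R) = norm R" by simp
  qed
qed

section \<open>Attaining the norm on a quasi-alpha family\<close>

text \<open>
  The functionals \<open>y \<circ> S\<close> are invariant, hence normed by the family, and their norms have supremum
  \<open>\<parallel>S\<parallel>\<close>.
\<close>

lemma norm_le_on_quasi_alpha_family:
  assumes fam: "quasi_alpha_family sX G \<Lambda> x x' \<rho>" and S: "S \<in> invariant_operators sX sY G"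
    and le: "\<And>m. m \<in> \<Lambda> \<Longrightarrow> norm (S (x m)) \<le> M"
  shows "norm S \<le> M"
proof (rule Y.norm_blinfun_le_dual_bound)
  fix y :: "'b \<Rightarrow>\<^sub>L 'k"
  assume y: "y \<in> dual_space sY" "norm y \<le> 1"
  obtain A where A: "A \<subseteq> x ` \<Lambda>" "(SUP a\<in>A. \<rho> a) < 1" "\<forall>d>0. \<exists>a\<in>A. norm (y o\<^sub>L S) - d < norm ((y o\<^sub>L S) a)"
    by (rule X.quasi_alpha_family_norming[OF fam compose_in_dual_space[OF S y(1)]])
  show "norm (y o\<^sub>L S) \<le> M"
  proof (rule field_le_epsilon)
    fix e :: real
    assume "e > 0"
    then obtain a where a: "a \<in> A" "norm (y o\<^sub>L S) - e < norm ((y o\<^sub>L S) a)"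
      using A(3) by blast
    have "norm ((y o\<^sub>L S) a) \<le> norm (S a)"
      using norm_contraction_le(1)[OF y(2)] by simp
    also have "\<dots> \<le> M"
      using a(1) A(1) le by blast
    finally show "norm (y o\<^sub>L S) \<le> M + e" using a(2) by linarith
  qed
qed

text \<open>
  Enlarging \<open>T\<close> in the direction of a member \<open>x l\<close> at which it almost attains its norm helps the
  other members less, by the factor \<open>q < 1\<close>, so that the perturbed operator attains its norm at
  \<open>x l\<close>.
\<close>

lemma norm_attaining_near_adjoint_norm_attaining:
  assumes fam: "quasi_alpha_family sX G \<Lambda> x x' \<rho>" and T: "T \<in> invariant_operators sX sY G"
    and y: "y \<in> dual_space sY" "norm y \<le> 1" "norm (y o\<^sub>L T) = norm T" and r: "r > 0"
  obtains S where "S \<in> NA_invariant_operators sX sY G" "dist S T < r"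
proof (cases "T = 0")
  case True
  then have "norm_attaining T"
    unfolding norm_attaining_def by (intro bexI[of _ 0]) auto
  then show ?thesis
    using T r by (intro that[of T]) (auto simp: NA_invariant_operators_def)
next
  case False
  define s where "s = norm T"
  have s: "s > 0" using False by (simp add: s_def)
  have unit: "\<And>l. l \<in> \<Lambda> \<Longrightarrow> norm (x l) = 1" "\<And>l. l \<in> \<Lambda> \<Longrightarrow> norm (x' l) = 1"
      "\<And>l. l \<in> \<Lambda> \<Longrightarrow> x' l \<in> dual_space sX" "\<And>l. l \<in> \<Lambda> \<Longrightarrow> invariant G (x' l)"
      "\<And>l. l \<in> \<Lambda> \<Longrightarrow> x' l (x l) = 1"
    and sep: "\<And>l m. l \<in> \<Lambda> \<Longrightarrow> m \<in> \<Lambda> \<Longrightarrow> l \<noteq> m \<Longrightarrow> norm (x' l (x m)) \<le> \<rho> (x l) \<and> \<rho> (x l) < 1"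
    using fam unfolding quasi_alpha_family_def by auto
  obtain A where A: "A \<subseteq> x ` \<Lambda>" "(SUP a\<in>A. \<rho> a) < 1"
      "\<forall>d>0. \<exists>a\<in>A. norm (y o\<^sub>L T) - d < norm ((y o\<^sub>L T) a)"
    by (rule X.quasi_alpha_family_norming[OF fam compose_in_dual_space[OF T y(1)]])
  define q where "q = max 0 (SUP a\<in>A. \<rho> a)"
  have q: "0 \<le> q" "q < 1" using A(2) by (auto simp: q_def)
  define \<eta> where "\<eta> = r / (2 * s)"
  have \<eta>: "\<eta> > 0" "\<eta> * s < r" using s r by (simp_all add: \<eta>_def)
  \<comment> \<open>chosen so that \<open>(1 + \<eta>) * (s - d) = s * (1 + \<eta> * q)\<close>, the bound for the other members\<close>
  define d where "d = s * \<eta> * (1 - q) / (1 + \<eta>)"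
  have "d > 0" using s \<eta> q by (simp add: d_def)
  then obtain a where a: "a \<in> A" "norm (y o\<^sub>L T) - d < norm ((y o\<^sub>L T) a)"
    using A(3) by blast
  then obtain l where l: "l \<in> \<Lambda>" "a = x l" using A(1) by blast
  have Ta: "s - d < norm (T (x l))" "norm (T (x l)) \<le> s"
    using a norm_contraction_le(1)[OF y(2), of "T a"] norm_blinfun_le_of_norm_le_one[of "x l" T]
    by (simp_all add: y(3) s_def l(2) unit(1)[OF l(1)])
  define S where "S = T + \<eta> *\<^sub>R rank_one sY (x' l) (T (x l))"
  have S: "S \<in> invariant_operators sX sY G"
    unfolding S_def by (intro perturbation_in_invariant_operators T unit l)
  have S_apply: "S z = T z + \<eta> *\<^sub>R sY (x' l z) (T (x l))" for z
    by (simp add: S_def blinfun.add_left blinfun.scaleR_left rank_one_apply)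
  have "S (x l) = (1 + \<eta>) *\<^sub>R T (x l)"
    by (simp add: S_apply unit(5)[OF l(1)] scaleR_add_left)
  then have Sl: "norm (S (x l)) = (1 + \<eta>) * norm (T (x l))"
    using \<eta> by simp
  have "norm S \<le> norm (S (x l))"
  proof (rule norm_le_on_quasi_alpha_family[OF fam S])
    fix m
    assume m: "m \<in> \<Lambda>"
    show "norm (S (x m)) \<le> norm (S (x l))"
    proof (cases "m = l")
      case False
      \<comment> \<open>boundedness is needed because the supremum of an unbounded set of reals is a default value;
        it holds since every index has a different partner among \<open>l\<close> and \<open>m\<close>\<close>
      have "\<rho> (x k) < 1" if "k \<in> \<Lambda>" for k
        using sep[OF that l(1)] sep[OF that m] False by (cases "k = l") auto
      then have "bdd_above (\<rho> ` A)"
        using A(1) by (intro bdd_aboveI2[of _ _ 1]) (auto intro: less_imp_le)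
      then have "\<rho> (x l) \<le> (SUP a\<in>A. \<rho> a)"
        using a(1) l(2) by (intro cSUP_upper) auto
      then have "norm (x' l (x m)) \<le> q"
        using sep[OF l(1) m] False by (auto simp: q_def)
      then have "norm (x' l (x m)) * norm (T (x l)) \<le> q * s"
        using Ta(2) q by (intro mult_mono) auto
      moreover have "norm (T (x m)) \<le> s"
        using norm_blinfun_le_of_norm_le_one[of "x m" T] unit(1)[OF m] by (simp add: s_def)
      moreover have "norm (S (x m)) \<le> norm (T (x m)) + \<eta> * (norm (x' l (x m)) * norm (T (x l)))"
        using norm_triangle_ineq[of "T (x m)" "\<eta> *\<^sub>R sY (x' l (x m)) (T (x l))"] \<eta>
        by (simp add: S_apply Y.norm_scale)
      ultimately have "norm (S (x m)) \<le> s + \<eta> * (q * s)"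
        using mult_left_mono[of "norm (x' l (x m)) * norm (T (x l))" "q * s" \<eta>] \<eta> by linarith
      also have "\<dots> = (1 + \<eta>) * (s - d)"
        using \<eta> by (simp add: d_def field_simps)
      also have "\<dots> \<le> (1 + \<eta>) * norm (T (x l))"
        using Ta(1) \<eta> by (intro mult_left_mono) auto
      finally show ?thesis by (simp add: Sl)
    qed simp
  qed
  moreover have "norm (S (x l)) \<le> norm S"
    by (rule norm_blinfun_le_of_norm_le_one) (simp add: unit(1)[OF l(1)])
  ultimately have "norm_attaining S"
    unfolding norm_attaining_def using unit(1)[OF l(1)] by (intro bexI[of _ "x l"]) auto
  moreover have "dist S T < r"
  proof -
    have "norm (rank_one sY (x' l) (T (x l))) \<le> s"
      using norm_rank_one_le[of "x' l" "T (x l)"] Ta(2) unit(2)[OF l(1)] by simp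
    then have "dist S T \<le> \<eta> * s"
      using \<eta> by (simp add: dist_norm S_def)
    with \<eta> show ?thesis by simp
  qed
  ultimately show ?thesis
    using S by (intro that[of S]) (auto simp: NA_invariant_operators_def)
qed

end

theorem theorem4p19:
  fixes sX :: "'k::real_or_complex_field \<Rightarrow> 'a::banach \<Rightarrow> 'a"
    and sY :: "'k \<Rightarrow> 'b::banach \<Rightarrow> 'b"
    and G :: "('a \<Rightarrow>\<^sub>L 'a) set"
  assumes "scalar_banach sX"
    and "isometry_group sX G"
    and "quasi_alpha sX G"
    and "scalar_banach sY"
  shows "invariant_operators sX sY G \<subseteq> closure (NA_invariant_operators sX sY G)"
proof
  interpret banach_pair sX sY G
    by (intro banach_pair.intro assms)
  obtain \<Lambda> :: "'a set" and x x' \<rho> where fam: "quasi_alpha_family sX G \<Lambda> x x' \<rho>"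
    using assms(3) unfolding quasi_alpha_def by (elim exE)
  fix T
  assume T: "T \<in> invariant_operators sX sY G"
  show "T \<in> closure (NA_invariant_operators sX sY G)"
    unfolding closure_approachable
  proof (intro allI impI)
    fix e :: real
    assume e: "e > 0"
    obtain R where R: "R \<in> invariant_operators sX sY G"
      "\<forall>n. R \<in> almost_norming_operators sX sY G (inverse (real (Suc n)))" "dist R T < e / 2"
      by (rule almost_norming_at_all_scales_dense[OF T half_gt_zero[OF e]])
    obtain y where y: "y \<in> dual_space sY" "norm y \<le> 1" "norm (y o\<^sub>L R) = norm R"
      by (rule adjoint_norm_attaining[OF R(2)])
    obtain S where S: "S \<in> NA_invariant_operators sX sY G" "dist S R < e / 2"
      by (rule norm_attaining_near_adjoint_norm_attaining[OF fam R(1) y half_gt_zero[OF e]])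
    have "dist S T < e"
      using dist_triangle[of S T R] S(2) R(3) by linarith
    with S(1) show "\<exists>S\<in>NA_invariant_operators sX sY G. dist S T < e" by (rule bexI[rotated])
  qed
qed

end
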